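(* There are constants $0<\lambda_0<\infty$ and $0<\varepsilon_0<1$ such that for $p=\frac1{2n}(1+\lambda_n n^{-1/3})$ with $\lambda_0\le|\lambda_n|\le\varepsilon_0n^{1/3}$, the following statements hold for the digraph $D_{F_{n,p}}$ with probability at least $1-\exp(-\Theta(|\lambda_n|^3))$: (i) if $\lambda_n<0$, there are at least $\Theta(|\lambda_n|^3)$ disjoint, mutually strictly distinct hourglasses whose in-portion and out-portion each have size at least $n^{2/3}/\lambda_n^2$; (ii) if $\lambda_n>0$, there is at least one hourglass whose in-portion and out-portion each have size $\Theta(\lambda_n n^{2/3})$.
   Context: Variables $x_1,\dots,x_n$, literals $x_i,\overline x_i$; literals $u,v$ are strictly distinct if $u\ne v$, $u\ne\overline v$; a set of literals is strictly distinct if its elements are pairwise strictly distinct. $F_{n,p}$ contains each of the $4\binom n2$ 2-clauses $u\vee v$ ($u,v$ strictly distinct, $u\vee v=v\vee u$) independently with probability $p$. The digraph $D_F$ on the literals has edge $x\to y$ iff $\overline x\vee y$ is a clause of $F$. An hourglass is a triple $(v,I_v,O_v)$ where $v$ is a literal and $I_v,O_v$ are disjoint sets of literals not containing $v$, such that for each $x\in I_v$ there is a directed path from $x$ to $v$ in $D_F$ using only vertices of $I_v\cup\{v\}$, for each $y\in O_v$ there is a directed path from $v$ to $y$ using only vertices of $O_v\cup\{v\}$, and $\{v\}\cup I_v\cup O_v$ is strictly distinct. $I_v$ is the in-portion and $O_v$ the out-portion. $\Theta(\cdot)$ denotes quantities bounded above and below by positive universal constant multiples. *)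

theory Defs
  imports "HOL-Probability.Probability" "Graph_Theory.Graph_Theory"
begin

datatype literal = Pos nat | Neg nat

fun negate :: "literal \<Rightarrow> literal" where
  "negate (Pos i) = Neg i"
| "negate (Neg i) = Pos i"

definition literals :: "nat \<Rightarrow> literal set" where
  "literals n = Pos ` {1..n} \<union> Neg ` {1..n}"

definition strictly_distinct :: "literal \<Rightarrow> literal \<Rightarrow> bool" where
  "strictly_distinct u v \<longleftrightarrow> u \<noteq> v \<and> u \<noteq> negate v"

definition strictly_distinct_set :: "literal set \<Rightarrow> bool" where
  "strictly_distinct_set S \<longleftrightarrow> pairwise strictly_distinct S"

text \<open>The clause \<open>u \<or> v = v \<or> u\<close> is the two-element set \<open>{u, v}\<close>; a formula is a set of clauses.\<close>

type_synonym clause = "literal set"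
type_synonym formula = "clause set"

definition clauses :: "nat \<Rightarrow> clause set" where
  "clauses n = {{u, v} | u v. u \<in> literals n \<and> v \<in> literals n \<and> strictly_distinct u v}"

definition random_formula :: "nat \<Rightarrow> real \<Rightarrow> formula pmf" where
  "random_formula n p =
     map_pmf (\<lambda>f. {c \<in> clauses n. f c}) (Pi_pmf (clauses n) False (\<lambda>_. bernoulli_pmf p))"

definition implication_digraph :: "nat \<Rightarrow> formula \<Rightarrow> (literal, literal \<times> literal) pre_digraph" where
  "implication_digraph n F =
     \<lparr>verts = literals n,
      arcs = {(x, y) \<in> literals n \<times> literals n. {negate x, y} \<in> F},
      tail = fst, head = snd\<rparr>"

definition path_within :: "('a, 'b) pre_digraph \<Rightarrow> 'a set \<Rightarrow> 'a \<Rightarrow> 'a \<Rightarrow> bool" where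
  "path_within G S x y \<longleftrightarrow> (\<exists>p. vpath p G \<and> hd p = x \<and> last p = y \<and> set p \<subseteq> S)"

type_synonym hourglass = "literal \<times> literal set \<times> literal set"

fun is_hourglass :: "(literal, 'b) pre_digraph \<Rightarrow> hourglass \<Rightarrow> bool" where
  "is_hourglass G (v, I, J) \<longleftrightarrow>
     v \<in> verts G \<and> I \<subseteq> verts G \<and> J \<subseteq> verts G \<and>
     I \<inter> J = {} \<and> v \<notin> I \<and> v \<notin> J \<and>
     (\<forall>x\<in>I. path_within G (insert v I) x v) \<and>
     (\<forall>y\<in>J. path_within G (insert v J) v y) \<and>
     strictly_distinct_set (insert v (I \<union> J))"

fun in_portion :: "hourglass \<Rightarrow> literal set" where
  "in_portion (v, I, J) = I"

fun out_portion :: "hourglass \<Rightarrow> literal set" where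
  "out_portion (v, I, J) = J"

fun hourglass_verts :: "hourglass \<Rightarrow> literal set" where
  "hourglass_verts (v, I, J) = insert v (I \<union> J)"

definition mutually_strictly_distinct :: "hourglass set \<Rightarrow> bool" where
  "mutually_strictly_distinct H \<longleftrightarrow>
     pairwise (\<lambda>h h'. \<forall>u\<in>hourglass_verts h. \<forall>w\<in>hourglass_verts h'. strictly_distinct u w) H"

definition disjoint_hourglasses :: "hourglass set \<Rightarrow> bool" where
  "disjoint_hourglasses H \<longleftrightarrow>
     pairwise (\<lambda>h h'. hourglass_verts h \<inter> hourglass_verts h' = {}) H"

end

(* The clauses are revealed one at a time by an adaptive exploration, so that the answers are
   independent coins and every step of the search consumes one of them.  A block of the exploration
   first performs a depth-first search.  A literal leaves the stack only after about 2n queries, so the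
   height of the stack is at least the number of positive answers minus the number of queries over 2n.
   If the coins have mean (1 + t)/(2n), this walk drifts upwards, and after the first third of the
   block, during the whole second third, the bottom part of the stack (the spine) stays in place:
   everything found in that time is reachable from the top v of the spine.  A backward search from the
   spine in the last third finds the literals from which v is reachable.  If a block explores about w
   vertices, this fails with probability exp(-c t^2 w).

   With e = |lambda| n^(-1/3), the supercritical case is one block with t = e and w of order e n.  In
   the subcritical case there are order e^3 n blocks with w of order 1/e^2.  A block is good with
   probability at least 1/2 for the supercritical coins of mean (1 + e)/(2n), hence, by Cauchy-Schwarz,
   with probability bounded below for the actual coins of mean (1 - e)/(2n), and a Chernoff bound
   gives linearly many good blocks. *)

theory Submission
  imports Defs
begin

subsection \<open>Independent coins\<close>

text \<open>Three rates, with factors 1 + t, 1 + t/2 and 1 + t/4 over 2n, shape the estimates: the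
  mean of the coins, the rate kept by a \<open>steady\<close> piece, and a bound on the literals
  exhausted per query. The first gap pays for the probability bound, the second for the growth of
  the stack. The last rate exceeds 1/(2n) because touched variables are lost as targets; therefore
  all blocks together must stay within t n/5 variables. This caps w in the supercritical case and
  the number of blocks in the subcritical one. There w is of order 1/e^2 so that both the failure
  exponent and the price of the change of measure are constants. The obstacle is that one clause
  carries two arcs, x to y and its contrapositive, so a backward query might already have been
  answered by the forward search. Keeping explored literals on distinct variables prevents this.
  Between blocks only the touched variables matter: a clause on two untouched variables is
  unrevealed. Once a block fails, its remaining coins are ignored, so all blocks have the same
  length and are independent.\<close>

abbreviation coins :: "nat \<Rightarrow> real \<Rightarrow> bool list pmf" where
  "coins N p \<equiv> replicate_pmf N (bernoulli_pmf p)"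

abbreviation heads :: "bool list \<Rightarrow> nat" where
  "heads l \<equiv> count_list l True"

lemma prob_bind_bernoulli:
  assumes "0 \<le> p" "p \<le> 1"
  shows "measure_pmf.prob (bind_pmf (bernoulli_pmf p) M) S =
    p * measure_pmf.prob (M True) S + (1 - p) * measure_pmf.prob (M False) S"
proof -
  have "ennreal (measure_pmf.prob (bind_pmf (bernoulli_pmf p) M) S) =
      ennreal (measure_pmf.prob (M True) S) * ennreal p + ennreal (measure_pmf.prob (M False) S) * ennreal (1 - p)"
    using assms
    by (simp add: measure_pmf.emeasure_eq_measure [symmetric])
  also have "\<dots> = ennreal (p * measure_pmf.prob (M True) S + (1 - p) * measure_pmf.prob (M False) S)"
    using assms by (simp add: ennreal_mult [symmetric] ennreal_plus [symmetric] mult.commute del: ennreal_plus)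
  finally show ?thesis
    using assms by (subst (asm) ennreal_inj) auto
qed

lemma prob_coins_Suc:
  assumes "0 \<le> p" "p \<le> 1"
  shows "measure_pmf.prob (coins (Suc N) p) S =
    p * measure_pmf.prob (coins N p) {l. True # l \<in> S} + (1 - p) * measure_pmf.prob (coins N p) {l. False # l \<in> S}"
proof -
  have *: "coins (Suc N) p = bind_pmf (bernoulli_pmf p) (\<lambda>b. map_pmf ((#) b) (coins N p))"
    by (simp add: map_pmf_def)
  show ?thesis
    unfolding * using assms by (simp add: prob_bind_bernoulli vimage_def)
qed

text \<open>By \<open>mgf\<close>, the exponential of \<open>\<theta>\<close> times
  (\<open>\<rho>\<close> q minus the heads among the first q coins) is a supermartingale, so this is
  its maximal inequality. Conditioning on the first coin moves the barrier \<open>y\<close> to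
  \<open>y + 1 - \<rho>\<close> or \<open>y - \<rho>\<close>.\<close>

lemma coins_maximal_inequality:
  fixes y :: real
  assumes p: "0 \<le> p" "p \<le> 1" and \<theta>: "0 \<le> \<theta>"
    and mgf: "p * exp (\<theta> * (\<rho> - 1)) + (1 - p) * exp (\<theta> * \<rho>) \<le> 1"
  shows "measure_pmf.prob (coins N p) {l. \<exists>q\<le>length l. heads (take q l) < \<rho> * q - y} \<le> exp (- \<theta> * y)"
proof (cases "y < 0")
  case True
  then have "1 \<le> exp (- \<theta> * y)"
    using \<theta> by (simp add: mult_nonneg_nonpos)
  then show ?thesis
    using measure_pmf.prob_le_1 order_trans by blast
next
  case False
  then have "0 \<le> y" by simp
  then show ?thesis
  proof (induction N arbitrary: y)
    case 0
    then show ?case by simp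
  next
    case (Suc N)
    define E where "E y = {l. \<exists>q\<le>length l. heads (take q l) < \<rho> * q - y}" for y :: real
    have step: "{l. b # l \<in> E y} \<subseteq> E (y + of_bool b - \<rho>)" for b
    proof
      fix l assume "l \<in> {l. b # l \<in> E y}"
      then obtain q where q: "q \<le> Suc (length l)" "heads (take q (b # l)) < \<rho> * q - y"
        by (auto simp: E_def)
      \<comment> \<open>At q = 0 the violation would read 0 < - y, impossible since y is nonnegative
        here.\<close>
      with Suc.prems have "q \<noteq> 0" by (intro notI) auto
      then obtain q' where "q = Suc q'" using not0_implies_Suc by blast
      with q show "l \<in> E (y + of_bool b - \<rho>)"
        by (auto simp: E_def algebra_simps intro!: exI [of _ q'] split: if_splits)
    qed
    have bound: "measure_pmf.prob (coins N p) (E z) \<le> exp (- \<theta> * z)" for z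
    proof (cases "z < 0")
      case True
      then have "1 \<le> exp (- \<theta> * z)"
        using \<theta> by (simp add: mult_nonneg_nonpos)
      then show ?thesis
        using measure_pmf.prob_le_1 order_trans by blast
    next
      case False
      then show ?thesis using Suc.IH [of z] by (simp add: E_def)
    qed
    have *: "measure_pmf.prob (coins N p) {l. b # l \<in> E y} \<le> exp (- \<theta> * (y + of_bool b - \<rho>))" for b
      by (rule order_trans [OF measure_pmf.finite_measure_mono [OF step] bound]) simp
    have "measure_pmf.prob (coins (Suc N) p) (E y) \<le>
        p * exp (- \<theta> * (y + of_bool True - \<rho>)) + (1 - p) * exp (- \<theta> * (y + of_bool False - \<rho>))"
      unfolding prob_coins_Suc [OF p] using p by (intro add_mono mult_left_mono *) auto
    also have "\<dots> = (p * exp (\<theta> * (\<rho> - 1)) + (1 - p) * exp (\<theta> * \<rho>)) * exp (- \<theta> * y)"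
      by (simp add: algebra_simps flip: exp_add)
    also have "\<dots> \<le> 1 * exp (- \<theta> * y)"
      by (rule mult_right_mono [OF mgf]) simp
    finally show ?case by (simp add: E_def)
  qed
qed

text \<open>Markov's inequality for 2^heads, whose expectation is (1 + p)^N.\<close>

lemma heads_tail_bound:
  assumes p: "0 \<le> p" "p \<le> 1"
  shows "measure_pmf.prob (coins N p) {l. (x::real) \<le> heads l} \<le> (1 + p) ^ N * 2 powr (- x)"
proof (induction N arbitrary: x)
  case 0
  show ?case
  proof (cases "x \<le> 0")
    case True
    then have "1 \<le> 2 powr (- x)" by (intro ge_one_powr_ge_zero) auto
    then show ?thesis by (simp add: indicator_def)
  qed simp
next
  case (Suc N)
  have "measure_pmf.prob (coins (Suc N) p) {l. x \<le> heads l} =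
     p * measure_pmf.prob (coins N p) {l. x - 1 \<le> heads l} + (1 - p) * measure_pmf.prob (coins N p) {l. x \<le> heads l}"
    unfolding prob_coins_Suc [OF p] by (simp add: algebra_simps)
  also have "\<dots> \<le> p * ((1 + p) ^ N * 2 powr (- (x - 1))) + (1 - p) * ((1 + p) ^ N * 2 powr (- x))"
    using p by (intro add_mono mult_left_mono Suc.IH) auto
  also have "2 powr (- (x - 1)) = 2 * 2 powr (- x)"
    by (simp add: powr_diff powr_minus field_simps)
  finally show ?case by (simp add: algebra_simps)
qed

text \<open>The second factor is the \<open>N\<close>-th power of the second moment of the likelihood ratio of one
  coin, so this is the Cauchy--Schwarz inequality for a change of measure.\<close>
lemma coins_change_of_measure:
  assumes p: "0 < p" "p < 1" and p': "0 \<le> p'" "p' \<le> 1"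
  shows "(measure_pmf.prob (coins N p') S)\<^sup>2 \<le>
    measure_pmf.prob (coins N p) S * (p'\<^sup>2 / p + (1 - p')\<^sup>2 / (1 - p)) ^ N"
proof (induction N arbitrary: S)
  case 0
  then show ?case by (simp add: indicator_def)
next
  case (Suc N)
  define \<xi> where "\<xi> = p'\<^sup>2 / p + (1 - p')\<^sup>2 / (1 - p)"
  define a where "a b = measure_pmf.prob (coins N p') {l. b # l \<in> S}" for b
  define s where "s b = measure_pmf.prob (coins N p) {l. b # l \<in> S}" for b
  have \<xi>: "0 \<le> \<xi>" using p by (simp add: \<xi>_def)
  have as: "(a b)\<^sup>2 \<le> s b * \<xi> ^ N" for b
    using Suc.IH by (simp add: a_def s_def \<xi>_def)
  \<comment> \<open>Lagrange's identity: the defect in the two-term Cauchy-Schwarz inequality is a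
    square.\<close>
  have "(p * (a True)\<^sup>2 + (1 - p) * (a False)\<^sup>2) * \<xi> - (p' * a True + (1 - p') * a False)\<^sup>2
      = (p * (1 - p')  * a True - (1 - p) * p' * a False)\<^sup>2 / (p * (1 - p))"
    using p by (simp add: \<xi>_def field_simps power2_eq_square)
  moreover have "0 \<le> \<dots>" using p by simp
  ultimately have "(p' * a True + (1 - p') * a False)\<^sup>2 \<le> (p * (a True)\<^sup>2 + (1 - p) * (a False)\<^sup>2) * \<xi>"
    by linarith
  also have "\<dots> \<le> (p * (s True * \<xi> ^ N) + (1 - p) * (s False * \<xi> ^ N)) * \<xi>"
    using p by (intro mult_right_mono add_mono mult_left_mono as \<xi>) auto
  finally show ?case
    using p p' by (simp add: prob_coins_Suc a_def [symmetric] s_def [symmetric] \<xi>_def [symmetric] algebra_simps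
        del: replicate_pmf.simps)
qed

lemma prob_coins_add:
  assumes p: "0 \<le> p" "p \<le> 1"
  shows "measure_pmf.prob (coins (M + N) p) {l. take M l \<in> S \<and> drop M l \<in> T} =
    measure_pmf.prob (coins M p) S * measure_pmf.prob (coins N p) T"
proof (induction M arbitrary: S)
  case 0
  then show ?case by (cases "[] \<in> S") simp_all
next
  case (Suc M)
  have "{l. b # l \<in> {l. take (Suc M) l \<in> S \<and> drop (Suc M) l \<in> T}} =
      {l. take M l \<in> {l. b # l \<in> S} \<and> drop M l \<in> T}" for b
    by auto
  then show ?case
    unfolding add_Suc prob_coins_Suc [OF p] by (simp only: Suc.IH) (simp add: algebra_simps)
qed

primrec good_blocks :: "nat \<Rightarrow> bool list set \<Rightarrow> nat \<Rightarrow> bool list \<Rightarrow> nat" where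
  "good_blocks L G 0 l = 0"
| "good_blocks L G (Suc J) l = of_bool (take L l \<in> G) + good_blocks L G J (drop L l)"

text \<open>Markov's inequality for 2 to the minus number of good blocks: an independent block that
  is good with probability g contributes the factor 1 - g/2.\<close>

lemma prob_few_good_blocks:
  assumes p: "0 \<le> p" "p \<le> 1" and q: "0 \<le> q" "q \<le> measure_pmf.prob (coins L p) G"
  shows "measure_pmf.prob (coins (J * L) p) {l. good_blocks L G J l \<le> (x::real)} \<le> (1 - q / 2) ^ J * 2 powr x"
proof (induction J arbitrary: x)
  case 0
  have "1 \<le> 2 powr x" if "0 \<le> x" using that by (simp add: ge_one_powr_ge_zero)
  then show ?case by auto
next
  case (Suc J)
  define g where "g = measure_pmf.prob (coins L p) G"
  let ?P = "\<lambda>x::real. measure_pmf.prob (coins (J * L) p) {l. good_blocks L G J l \<le> x}"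
  have "{l. good_blocks L G (Suc J) l \<le> x} =
      {l. take L l \<in> G \<and> drop L l \<in> {l. good_blocks L G J l \<le> x - 1}} \<union>
      {l. take L l \<in> - G \<and> drop L l \<in> {l. good_blocks L G J l \<le> x}}"
    by (auto simp: algebra_simps)
  then have "measure_pmf.prob (coins (Suc J * L) p) {l. good_blocks L G (Suc J) l \<le> x} \<le>
      measure_pmf.prob (coins (L + J * L) p) {l. take L l \<in> G \<and> drop L l \<in> {l. good_blocks L G J l \<le> x - 1}} +
      measure_pmf.prob (coins (L + J * L) p) {l. take L l \<in> - G \<and> drop L l \<in> {l. good_blocks L G J l \<le> x}}"
    by (simp add: measure_Un_le)
  also have "\<dots> = g * ?P (x - 1) + (1 - g) * ?P x"
    unfolding prob_coins_add [OF p] by (simp add: g_def measure_pmf.prob_compl [of G, simplified] Compl_eq_Diff_UNIV)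
  also have "\<dots> \<le> g * ((1 - q / 2) ^ J * 2 powr (x - 1)) + (1 - g) * ((1 - q / 2) ^ J * 2 powr x)"
    by (intro add_mono mult_left_mono Suc.IH) (auto simp: g_def)
  also have "2 powr (x - 1) = 2 powr x / 2"
    by (simp add: powr_diff)
  also have "g * ((1 - q / 2) ^ J * (2 powr x / 2)) + (1 - g) * ((1 - q / 2) ^ J * 2 powr x) =
      (1 - g / 2) * ((1 - q / 2) ^ J * 2 powr x)"
    by (simp add: algebra_simps)
  also have "\<dots> \<le> (1 - q / 2) * ((1 - q / 2) ^ J * 2 powr x)"
    using q order_trans [OF q(2) measure_pmf.prob_le_1]
    by (intro mult_right_mono mult_nonneg_nonneg zero_le_power) (auto simp: g_def)
  finally show ?case by simp
qed

subsection \<open>Adaptive exploration of a random subset\<close>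

definition random_subset :: "'c set \<Rightarrow> real \<Rightarrow> 'c set pmf" where
  "random_subset A p = map_pmf (\<lambda>f. {c \<in> A. f c}) (Pi_pmf A False (\<lambda>_. bernoulli_pmf p))"

lemma random_subset_insert:
  assumes "finite A" "c \<notin> A"
  shows "random_subset (insert c A) p =
    bind_pmf (bernoulli_pmf p) (\<lambda>b. map_pmf (\<lambda>X. if b then insert c X else X) (random_subset A p))"
proof -
  have *: "{c'. (c' = c \<or> c' \<in> A) \<and> (c' = c \<and> b \<or> c' \<noteq> c \<and> f c')} =
      (if b then insert c {c \<in> A. f c} else {c \<in> A. f c})" for b f
    using assms by auto
  show ?thesis
    unfolding random_subset_def Pi_pmf_insert' [OF assms] map_bind_pmf
    by (simp add: map_pmf_def bind_assoc_pmf bind_return_pmf fun_upd_def if_bool_eq_disj * cong: conj_cong)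
qed

text \<open>\<open>explores A N K P R\<close>: an adaptive exploration of a random subset of \<open>A\<close>, of which \<open>K\<close> has been
  revealed and \<open>P\<close> found present, can consume \<open>N\<close> coins, each of which either answers a fresh query
  or is ignored, so that \<open>R\<close> relates the coins to the final revealed and present sets.\<close>
primrec explores :: "'c set \<Rightarrow> nat \<Rightarrow> 'c set \<Rightarrow> 'c set \<Rightarrow> (bool list \<Rightarrow> 'c set \<Rightarrow> 'c set \<Rightarrow> bool) \<Rightarrow> bool" where
  "explores A 0 K P R \<longleftrightarrow> R [] K P"
| "explores A (Suc N) K P R \<longleftrightarrow>
    (\<exists>c\<in>A - K. \<forall>b. explores A N (insert c K) (if b then insert c P else P) (\<lambda>l. R (b # l))) \<or>
    (\<forall>b. explores A N K P (\<lambda>l. R (b # l)))"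

lemma explores_mono:
  assumes "explores A N K P R" and "\<And>l K' P'. length l = N \<Longrightarrow> R l K' P' \<Longrightarrow> R' l K' P'"
  shows "explores A N K P R'"
  using assms
proof (induction N arbitrary: K P R R')
  case 0
  then show ?case by simp
next
  case (Suc N)
  have *: "explores A N K' P' (\<lambda>l. R (b # l)) \<Longrightarrow> explores A N K' P' (\<lambda>l. R' (b # l))" for b K' P'
    by (erule Suc.IH) (simp add: Suc.prems(2))
  from Suc.prems(1) show ?case
    unfolding explores.simps using * by meson
qed

lemma explores_invariant:
  assumes "I [] K P"
    and "\<And>l K P. length l < N \<Longrightarrow> I l K P \<Longrightarrow>
      (\<exists>c\<in>A - K. \<forall>b. I (l @ [b]) (insert c K) (if b then insert c P else P)) \<or> (\<forall>b. I (l @ [b]) K P)"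
  shows "explores A N K P I"
proof -
  \<comment> \<open>\<open>explores\<close> takes coins off the front while \<open>I\<close> grows
    at the end; fixing the consumed prefix \<open>l0\<close> reconciles the two.\<close>
  have "explores A M K P (\<lambda>l. I (l0 @ l))" if "length l0 + M = N" "I l0 K P" for M l0 K P
    using that
  proof (induction M arbitrary: l0 K P)
    case 0
    then show ?case by simp
  next
    case (Suc M)
    have *: "explores A M K' P' (\<lambda>l. I (l0 @ b # l))" if "I (l0 @ [b]) K' P'" for b K' P'
      using Suc.IH [of "l0 @ [b]" K' P'] Suc.prems that by simp
    have "length l0 < N" using Suc.prems by simp
    from assms(2) [OF this Suc.prems(2)] show ?case
      unfolding explores.simps using * by meson
  qed
  from this [of "[]" N K P] assms(1) show ?thesis by simp
qed

text \<open>The strategy queries while the coins are \<open>ok\<close> and idles from the first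
  violation on. As \<open>ok\<close> passes to prefixes, a violated history never recovers;
  \<open>kn\<close> preserves what the next stage must know in either case.\<close>

lemma explores_while:
  assumes "kn K P" "ok [] \<Longrightarrow> S [] K P" and prefix: "\<And>l b. ok (l @ [b]) \<Longrightarrow> ok l"
    and step: "\<And>l K P. length l < N \<Longrightarrow> ok l \<Longrightarrow> S l K P \<Longrightarrow>
      \<exists>c\<in>A - K. \<forall>b. S (l @ [b]) (insert c K) (if b then insert c P else P) \<and>
        kn (insert c K) (if b then insert c P else P)"
  shows "explores A N K P (\<lambda>l K P. kn K P \<and> (ok l \<longrightarrow> S l K P))"
proof (rule explores_invariant)
  show "kn K P \<and> (ok [] \<longrightarrow> S [] K P)" using assms(1,2) by blast
next
  fix l K P assume l: "length l < N" and I: "kn K P \<and> (ok l \<longrightarrow> S l K P)"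
  show "(\<exists>c\<in>A - K. \<forall>b. kn (insert c K) (if b then insert c P else P) \<and>
        (ok (l @ [b]) \<longrightarrow> S (l @ [b]) (insert c K) (if b then insert c P else P))) \<or>
      (\<forall>b. kn K P \<and> (ok (l @ [b]) \<longrightarrow> S (l @ [b]) K P))"
  proof (cases "ok l")
    case True
    with I step [OF l] show ?thesis by blast
  next
    case False
    with I prefix show ?thesis by blast
  qed
qed

lemma explores_append:
  assumes "explores A M K P R"
    and "\<And>l K' P'. length l = M \<Longrightarrow> R l K' P' \<Longrightarrow> explores A N K' P' (\<lambda>l'. R' (l @ l'))"
  shows "explores A (M + N) K P R'"
  using assms
proof (induction M arbitrary: K P R R')
  case 0
  then show ?case by simp
next
  case (Suc M)
  have *: "explores A (M + N) K' P' (\<lambda>l. R' (b # l))" if "explores A M K' P' (\<lambda>l. R (b # l))" for b K' P'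
    by (rule Suc.IH [OF that]) (use Suc.prems(2) [of "b # _"] in simp)
  from Suc.prems(1) show ?case
    unfolding add_Suc explores.simps using * by meson
qed

text \<open>Given the answers so far, the random set is \<open>P\<close> together with a random
  subset of the unrevealed \<open>A - K\<close>. A query splits one element off that subset, an
  ignored coin leaves it alone. Quantifying over all outcomes allowed by \<open>R\<close> avoids
  naming the strategy; quantifying over supersets \<open>F\<close> makes the unrevealed elements
  harmless.\<close>

lemma explores_prob:
  assumes "finite A" and p: "0 \<le> p" "p \<le> 1" and "explores A N K P R"
  shows "measure_pmf.prob (coins N p) {l. \<forall>K' P'. R l K' P' \<longrightarrow> (\<forall>F. P' \<subseteq> F \<longrightarrow> \<Phi> F)} \<le>
    measure_pmf.prob (map_pmf (\<lambda>X. P \<union> X) (random_subset (A - K) p)) {F. \<Phi> F}"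
  using assms(4)
proof (induction N arbitrary: K P R)
  case 0
  have "measure_pmf.prob (map_pmf (\<lambda>X. P \<union> X) (random_subset (A - K) p)) {F. \<Phi> F} = 1"
    if "\<forall>F. P \<subseteq> F \<longrightarrow> \<Phi> F"
    using that by (simp add: vimage_def)
  with 0 show ?case by (auto simp: indicator_def simp del: measure_map_pmf)
next
  case (Suc N)
  let ?W = "\<lambda>R. {l. \<forall>K' P'. R l K' P' \<longrightarrow> (\<forall>F. P' \<subseteq> F \<longrightarrow> \<Phi> F)}"
  let ?M = "\<lambda>K P. map_pmf (\<lambda>X. P \<union> X) (random_subset (A - K) p)"
  have lhs: "measure_pmf.prob (coins (Suc N) p) (?W R) =
      p * measure_pmf.prob (coins N p) (?W (\<lambda>l. R (True # l))) +
      (1 - p) * measure_pmf.prob (coins N p) (?W (\<lambda>l. R (False # l)))"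
    unfolding prob_coins_Suc [OF p] by simp
  from Suc.prems consider
      (query) c where "c \<in> A - K"
        "\<And>b. explores A N (insert c K) (if b then insert c P else P) (\<lambda>l. R (b # l))"
    | (idle) "\<And>b. explores A N K P (\<lambda>l. R (b # l))"
    by auto
  then show ?case
  proof cases
    case query
    let ?S = "random_subset (A - insert c K) p"
    have *: "A - K = insert c (A - insert c K)" using query(1) by blast
    have "random_subset (A - K) p =
        bind_pmf (bernoulli_pmf p) (\<lambda>b. map_pmf (\<lambda>X. if b then insert c X else X) ?S)"
      unfolding * by (rule random_subset_insert) (use \<open>finite A\<close> in auto)
    then have "?M K P = bind_pmf (bernoulli_pmf p)
        (\<lambda>b. map_pmf ((\<union>) P \<circ> (\<lambda>X. if b then insert c X else X)) ?S)"
      by (simp only: map_bind_pmf pmf.map_comp)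
    moreover have "(\<union>) P \<circ> (\<lambda>X. if b then insert c X else X) = (\<union>) (if b then insert c P else P)" for b
      by auto
    ultimately have "?M K P =
        bind_pmf (bernoulli_pmf p) (\<lambda>b. ?M (insert c K) (if b then insert c P else P))"
      by (simp only:)
    then have "measure_pmf.prob (?M K P) {F. \<Phi> F} =
        p * measure_pmf.prob (?M (insert c K) (if True then insert c P else P)) {F. \<Phi> F} +
        (1 - p) * measure_pmf.prob (?M (insert c K) (if False then insert c P else P)) {F. \<Phi> F}"
      using p by (simp only: prob_bind_bernoulli)
    then show ?thesis
      unfolding lhs using p by (simp only:) (intro add_mono mult_left_mono Suc.IH query(2), auto)
  next
    case idle
    have "measure_pmf.prob (?M K P) {F. \<Phi> F} =
        p * measure_pmf.prob (?M K P) {F. \<Phi> F} + (1 - p) * measure_pmf.prob (?M K P) {F. \<Phi> F}"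
      by (simp add: algebra_simps)
    moreover have "measure_pmf.prob (coins (Suc N) p) (?W R) \<le> \<dots>"
      unfolding lhs using p by (intro add_mono mult_left_mono Suc.IH idle) auto
    ultimately show ?thesis by simp
  qed
qed

subsection \<open>Literals and clauses\<close>

fun lit_var :: "literal \<Rightarrow> nat" where
  "lit_var (Pos i) = i"
| "lit_var (Neg i) = i"

text \<open>As sets, \<open>edge x y\<close> and \<open>edge (negate y) (negate x)\<close> coincide:
  an arc and its contrapositive are one query.\<close>

abbreviation edge :: "literal \<Rightarrow> literal \<Rightarrow> clause" where
  "edge x y \<equiv> {negate x, y}"

lemma negate_negate [simp]: "negate (negate x) = x"
  by (cases x) auto

lemma lit_var_negate [simp]: "lit_var (negate x) = lit_var x"
  by (cases x) auto

lemma in_literals_iff: "x \<in> literals n \<longleftrightarrow> lit_var x \<in> {1..n}"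
  by (cases x) (auto simp: literals_def)

lemma finite_literals [simp]: "finite (literals n)"
  by (simp add: literals_def)

lemma finite_clauses [simp]: "finite (clauses n)"
proof (rule finite_subset)
  show "clauses n \<subseteq> Pow (literals n)" by (auto simp: clauses_def)
qed simp

lemma lit_var_eq_iff: "lit_var x = lit_var y \<longleftrightarrow> x = y \<or> x = negate y"
  by (cases x; cases y) auto

lemma strictly_distinct_iff: "strictly_distinct x y \<longleftrightarrow> lit_var x \<noteq> lit_var y"
  by (auto simp: strictly_distinct_def lit_var_eq_iff)

lemma edge_in_clauses:
  assumes "x \<in> literals n" "y \<in> literals n" "lit_var x \<noteq> lit_var y"
  shows "edge x y \<in> clauses n"
proof -
  have "negate x \<in> literals n" "strictly_distinct (negate x) y"
    using assms by (simp_all add: in_literals_iff strictly_distinct_iff)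
  with assms(2) show ?thesis unfolding clauses_def by blast
qed

text \<open>The only other way for the two clauses to agree is as contrapositives, with
  \<open>y = negate x'\<close>; the variable condition excludes it.\<close>

lemma edge_eqD:
  assumes "edge x y = edge x' y'" "lit_var y \<noteq> lit_var x'"
  shows "x = x' \<and> y = y'"
proof -
  have "y \<noteq> negate x'" using assms(2) by auto
  with assms(1) have "negate x = negate x'" "y = y'" by (auto simp: doubleton_eq_iff)
  then show ?thesis by (metis negate_negate)
qed

lemma edge_eq_swapD:
  assumes "edge x y = edge x' y'" "lit_var x \<noteq> lit_var y'"
  shows "x = x' \<and> y = y'"
proof -
  have "negate x \<noteq> y'" using assms(2) by auto
  with assms(1) have "negate x = negate x'" "y = y'" by (auto simp: doubleton_eq_iff)
  then show ?thesis by (metis negate_negate)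
qed

definition out_edges :: "nat \<Rightarrow> literal set \<Rightarrow> formula" where
  "out_edges n X = {edge x y | x y. x \<in> X \<and> y \<in> literals n \<and> lit_var x \<noteq> lit_var y}"

lemma out_edgesI:
  "x \<in> X \<Longrightarrow> y \<in> literals n \<Longrightarrow> lit_var x \<noteq> lit_var y \<Longrightarrow> edge x y \<in> out_edges n X"
  by (auto simp: out_edges_def)

lemma out_edges_mono: "X \<subseteq> Y \<Longrightarrow> out_edges n X \<subseteq> out_edges n Y"
  by (auto simp: out_edges_def)

lemma out_edges_subset_clauses: "X \<subseteq> literals n \<Longrightarrow> out_edges n X \<subseteq> clauses n"
  by (auto simp: out_edges_def intro!: edge_in_clauses)

lemma card_fresh_literals:
  assumes "V \<subseteq> {1..n}"
  shows "card {y \<in> literals n. lit_var y \<notin> V} = 2 * (n - card V)"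
proof -
  have "{y \<in> literals n. lit_var y \<notin> V} = Pos ` ({1..n} - V) \<union> Neg ` ({1..n} - V)"
    by (auto simp: literals_def)
  moreover have "card (Pos ` ({1..n} - V) \<union> Neg ` ({1..n} - V)) = card ({1..n} - V) + card ({1..n} - V)"
    by (subst card_Un_disjoint) (auto simp: card_image inj_on_def)
  moreover have "card ({1..n} - V) = n - card V"
    using assms by (simp add: card_Diff_subset finite_subset)
  ultimately show ?thesis by simp
qed

text \<open>The price of exhausting \<open>X\<close>: every member costs one query per literal on a
  variable outside \<open>V\<close>, and injectivity prevents double counting.\<close>

lemma card_times_fresh_le:
  assumes "finite K" "V \<subseteq> {1..n}" "finite X"
    and "\<And>x y. x \<in> X \<Longrightarrow> y \<in> literals n \<Longrightarrow> lit_var y \<notin> V \<Longrightarrow> f (x, y) \<in> K"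
    and "inj_on f (X \<times> {y \<in> literals n. lit_var y \<notin> V})"
  shows "card X * (2 * (n - card V)) \<le> card K"
proof -
  have "card (X \<times> {y \<in> literals n. lit_var y \<notin> V}) \<le> card K"
    using assms(4) by (intro card_inj_on_le [OF assms(5) _ assms(1)]) auto
  then show ?thesis
    by (simp add: card_cartesian_product card_fresh_literals [OF assms(2)])
qed

subsection \<open>Paths in implication digraphs\<close>

lemma arcs_ends_implication_digraph:
  "arcs_ends (implication_digraph n P) = {(x, y) \<in> literals n \<times> literals n. edge x y \<in> P}"
  by (auto simp: arcs_ends_conv implication_digraph_def image_iff)

lemma verts_implication_digraph [simp]: "verts (implication_digraph n P) = literals n"
  by (simp add: implication_digraph_def)

lemma path_within_refl: "x \<in> literals n \<Longrightarrow> x \<in> S \<Longrightarrow> path_within (implication_digraph n P) S x x"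
  by (auto simp: path_within_def vpath_def vwalk_def intro!: exI [of _ "[x]"])

lemma path_within_mono:
  assumes "path_within (implication_digraph n P) S x y" "P \<subseteq> P'" "S \<subseteq> S'"
  shows "path_within (implication_digraph n P') S' x y"
proof -
  have "arcs_ends (implication_digraph n P) \<subseteq> arcs_ends (implication_digraph n P')"
    using assms(2) by (auto simp: arcs_ends_implication_digraph)
  then show ?thesis
    using assms(1,3) unfolding path_within_def vpath_def vwalk_def verts_implication_digraph by blast
qed

lemma path_within_snoc:
  assumes "path_within (implication_digraph n P) S v x" "y \<notin> S" "y \<in> literals n" "edge x y \<in> P"
  shows "path_within (implication_digraph n P) (insert y S) v y"
proof -
  from assms(1) obtain p where p: "vpath p (implication_digraph n P)" "hd p = v" "last p = x" "set p \<subseteq> S"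
    by (auto simp: path_within_def)
  then have "p \<noteq> []" "set p \<subseteq> literals n" by (auto simp: vpath_def vwalk_def)
  with p(3) have "x \<in> literals n" using last_in_set by blast
  have "vpath (p @ [y]) (implication_digraph n P)"
    using p assms \<open>p \<noteq> []\<close> \<open>x \<in> literals n\<close>
    by (auto simp: vpath_def vwalk_def vwalk_arcs_append arcs_ends_implication_digraph)
  then show ?thesis
    unfolding path_within_def using p \<open>p \<noteq> []\<close> by (intro exI [of _ "p @ [y]"]) auto
qed

lemma path_within_Cons:
  assumes "path_within (implication_digraph n P) S x v" "y \<notin> S" "y \<in> literals n" "edge y x \<in> P"
  shows "path_within (implication_digraph n P) (insert y S) y v"
proof -
  from assms(1) obtain p where p: "vpath p (implication_digraph n P)" "hd p = x" "last p = v" "set p \<subseteq> S"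
    by (auto simp: path_within_def)
  then have "p \<noteq> []" "set p \<subseteq> literals n" by (auto simp: vpath_def vwalk_def)
  with p(2) have "x \<in> literals n" using hd_in_set by blast
  have "vpath (y # p) (implication_digraph n P)"
    using p assms \<open>p \<noteq> []\<close> \<open>x \<in> literals n\<close>
    by (auto simp: vpath_def vwalk_def arcs_ends_implication_digraph)
  then show ?thesis
    unfolding path_within_def using p \<open>p \<noteq> []\<close> by (intro exI [of _ "y # p"]) auto
qed

lemma is_hourglass_mono:
  assumes "is_hourglass (implication_digraph n P) h" "P \<subseteq> P'"
  shows "is_hourglass (implication_digraph n P') h"
proof (cases h)
  case (fields v I J)
  with assms show ?thesis by (auto intro: path_within_mono)
qed

text \<open>The head of the list is the top of the stack, so arcs run from the deeper literal
  \<open>b\<close> to \<open>a\<close> above it.\<close>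

abbreviation stack_path :: "formula \<Rightarrow> literal list \<Rightarrow> bool" where
  "stack_path P \<equiv> successively (\<lambda>a b. edge b a \<in> P)"

lemma stack_path_to_hd:
  assumes "stack_path P B" "distinct B" "set B \<subseteq> literals n" "x \<in> set B"
  shows "path_within (implication_digraph n P) (set B) x (hd B)"
  using assms
proof (induction B)
  case (Cons v B)
  show ?case
  proof (cases "x = v")
    case True
    then show ?thesis using Cons.prems by (auto intro: path_within_refl)
  next
    case False
    then have "x \<in> set B" using Cons.prems by simp
    then have "B \<noteq> []" by auto
    then have "path_within (implication_digraph n P) (insert v (set B)) x v"
      using Cons \<open>x \<in> set B\<close> by (intro path_within_snoc [where x = "hd B"]) (auto simp: successively_Cons)
    then show ?thesis by simp
  qed
qed simp

lemma stack_path_from_hd: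
  assumes "stack_path P (st @ B)" "distinct (st @ B)" "set (st @ B) \<subseteq> literals n" "B \<noteq> []" "y \<in> set st"
  shows "path_within (implication_digraph n P) (insert (hd B) (set st)) (hd B) y"
  using assms
proof (induction st arbitrary: y)
  case (Cons a st)
  show ?case
  proof (cases "y = a")
    case True
    have v: "hd B \<in> set B" using Cons.prems by simp
    have "path_within (implication_digraph n P) (insert a (insert (hd B) (set st))) (hd B) a"
    proof (rule path_within_snoc [where x = "hd (st @ B)"])
      show "path_within (implication_digraph n P) (insert (hd B) (set st)) (hd B) (hd (st @ B))"
      proof (cases "st = []")
        case True
        then show ?thesis using v Cons.prems by (auto intro!: path_within_refl)
      next
        case False
        then show ?thesis
          using Cons.prems by (simp add: hd_append) (intro Cons.IH, auto simp: successively_Cons)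
      qed
      show "a \<notin> insert (hd B) (set st)" using v Cons.prems by auto
      show "a \<in> literals n" using Cons.prems by simp
      show "edge (hd (st @ B)) a \<in> P" using Cons.prems by (simp add: successively_Cons)
    qed
    then show ?thesis using True by (simp add: insert_commute)
  next
    case False
    then have "path_within (implication_digraph n P) (insert (hd B) (set st)) (hd B) y"
      using Cons.prems by (intro Cons.IH) (auto simp: successively_Cons)
    then show ?thesis by (rule path_within_mono) auto
  qed
qed simp


subsection \<open>Depth-first search\<close>

text \<open>One block with an arbitrary past: touched variables \<open>V0\<close>, revealed clauses
  \<open>K0\<close>, present clauses \<open>P0\<close>. The budget \<open>32 * w\<close> bounds the
  variables newly touched by the block.\<close>

locale exploration =
  fixes n w :: nat and \<tau> :: real and V0 :: "nat set" and K0 P0 :: formula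
  assumes n: "0 < n" and w: "1 \<le> w" and \<tau>: "0 < \<tau>" "\<tau> \<le> 1"
    and V0: "V0 \<subseteq> {1..n}" and K0: "K0 \<subseteq> clauses n" and P0: "P0 \<subseteq> K0"
    and K0_touched: "\<And>c. c \<in> K0 \<Longrightarrow> \<exists>z\<in>c. lit_var z \<in> V0"
    and room: "real (card V0 + 32 * w) \<le> \<tau> * n / 5"
begin

text \<open>An upper bound for 1/(2(n - m)), the literals exhausted per query when m variables are
  touched; the excess \<open>\<tau> / 4\<close> absorbs every m up to \<tau> n/5.\<close>

definition r :: real where "r = (1 + \<tau> / 4) / (2 * n)"

lemma r_pos: "0 < r"
  using n \<tau> by (simp add: r_def)

lemma room_fresh:
  assumes "m \<le> card V0 + 32 * w"
  shows "m < n" "1 \<le> real (2 * (n - m)) * r"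
proof -
  have m: "real m \<le> \<tau> * n / 5" using assms room by linarith
  also have "\<dots> \<le> 1 * n / 5" using \<tau> by (intro divide_right_mono) (auto intro!: mult_left_le_one_le)
  also have "\<dots> < n" using n by simp
  finally show "m < n" by simp
  \<comment> \<open>The product in the next line equals 1 + \<tau>(1 - \<tau>)/20.\<close>
  have "0 \<le> \<tau> * (1 - \<tau>)" using \<tau> by simp
  then have "1 \<le> (1 - \<tau> / 5) * (1 + \<tau> / 4)" by (simp add: algebra_simps)
  then have "real n \<le> real n * ((1 - \<tau> / 5) * (1 + \<tau> / 4))" using n by simp
  also have "\<dots> = (real n - \<tau> * n / 5) * (1 + \<tau> / 4)" by (simp add: field_simps)
  also have "\<dots> \<le> (real n - m) * (1 + \<tau> / 4)" using m \<tau> by (intro mult_right_mono) auto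
  finally show "1 \<le> real (2 * (n - m)) * r"
    using n \<open>m < n\<close> by (simp add: r_def field_simps of_nat_diff)
qed

lemma finite_V0: "finite V0"
  using V0 finite_subset by auto

definition seen :: "literal set \<Rightarrow> nat set" where
  "seen X = V0 \<union> lit_var ` X"

lemma card_seen_le: "finite X \<Longrightarrow> card (seen X) \<le> card V0 + card X"
  unfolding seen_def by (meson card_Un_le card_image_le add_left_mono order_trans)

lemma seen_subset: "X \<subseteq> literals n \<Longrightarrow> seen X \<subseteq> {1..n}"
  using V0 by (auto simp: seen_def in_literals_iff subset_iff)

text \<open>\<open>T\<close> holds the exhausted literals, popped from the stack. New clauses are
  confined to out-edges of explored literals, which later keeps the backward queries fresh. The
  bound on \<open>card T\<close> follows from exhaustion but is carried along, because proving it
  after a pop uses its validity before the pop.\<close>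

definition dfs :: "nat \<Rightarrow> formula \<Rightarrow> formula \<Rightarrow> literal list \<Rightarrow> literal set \<Rightarrow> bool" where
  "dfs k K P st T \<longleftrightarrow>
    distinct st \<and> set st \<inter> T = {} \<and> set st \<union> T \<subseteq> literals n \<and>
    inj_on lit_var (set st \<union> T) \<and> lit_var ` (set st \<union> T) \<inter> V0 = {} \<and>
    K0 \<subseteq> K \<and> K \<subseteq> K0 \<union> out_edges n (set st \<union> T) \<and>
    P0 \<subseteq> P \<and> P \<subseteq> K \<and> card (K - K0) \<le> k \<and>
    (\<forall>x\<in>T. \<forall>y\<in>literals n. lit_var y \<notin> seen (set st \<union> T) \<longrightarrow> edge x y \<in> K) \<and>
    stack_path P st \<and> card T \<le> k * r"

lemma dfs_clauses: "dfs k K P st T \<Longrightarrow> K \<subseteq> clauses n"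
  using K0 out_edges_subset_clauses unfolding dfs_def by (meson Un_least order_trans)

lemma dfs_finite: "dfs k K P st T \<Longrightarrow> finite T"
  unfolding dfs_def using finite_literals finite_subset by (metis Un_subset_iff)

lemma dfs_card_seen:
  assumes "dfs k K P st T" "k * r \<le> 3 * w"
  shows "card (seen (set st \<union> T)) \<le> card V0 + length st + 3 * w"
proof -
  have "real (card T) \<le> real (3 * w)" using assms by (auto simp: dfs_def)
  then have "card T \<le> 3 * w" by linarith
  moreover have "card (set st \<union> T) \<le> length st + card T"
    by (meson add_right_mono card_Un_le card_length order_trans)
  ultimately show ?thesis
    using card_seen_le [of "set st \<union> T"] dfs_finite [OF assms(1)] by simp
qed

lemma fresh_not_in_K0:
  assumes "lit_var x \<notin> V0" "lit_var y \<notin> V0"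
  shows "edge x y \<notin> K0"
  using assms K0_touched by fastforce

text \<open>Every literal of \<open>X\<close> has been asked about all literals on unseen variables,
  at least 1/\<open>r\<close> of them. None of these clauses lies in \<open>K0\<close>, and at most
  \<open>k\<close> were revealed in this block. The bound on \<open>T\<close> contained in
  \<open>dfs\<close> limits the seen variables, as \<open>room_fresh\<close> requires.\<close>

lemma dfs_exhausted_card:
  assumes "dfs k K P st T" "k * r \<le> 3 * w" "length st \<le> 29 * w" "X \<subseteq> set st \<union> T"
    and "\<And>x y. x \<in> X \<Longrightarrow> y \<in> literals n \<Longrightarrow> lit_var y \<notin> seen (set st \<union> T) \<Longrightarrow> edge x y \<in> K"
  shows "card X \<le> k * r"
proof -
  define V where "V = seen (set st \<union> T)"
  have V: "V \<subseteq> {1..n}" using assms(1) seen_subset by (simp add: V_def dfs_def)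
  have finX: "finite X" using assms(4) dfs_finite [OF assms(1)] finite_subset by auto
  have XV: "lit_var x \<in> V" if "x \<in> X" for x
    using assms(4) that by (auto simp: V_def seen_def)
  have "card X * (2 * (n - card V)) \<le> card (K - K0)"
  proof (rule card_times_fresh_le [OF _ V finX])
    show "finite (K - K0)"
      using finite_subset [OF dfs_clauses [OF assms(1)] finite_clauses] by simp
    show "(\<lambda>(x, y). edge x y) (x, y) \<in> K - K0"
      if "x \<in> X" "y \<in> literals n" "lit_var y \<notin> V" for x y
    proof -
      have "lit_var x \<in> lit_var ` (set st \<union> T)" using that(1) assms(4) by blast
      then have "lit_var x \<notin> V0" using assms(1) unfolding dfs_def by blast
      moreover have "lit_var y \<notin> V0" using that by (auto simp: V_def seen_def)
      ultimately show ?thesis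
        using assms(5) that fresh_not_in_K0 by (simp add: V_def)
    qed
    show "inj_on (\<lambda>(x, y). edge x y) (X \<times> {y \<in> literals n. lit_var y \<notin> V})"
      by (rule inj_onI) (use XV in \<open>auto dest!: edge_eqD\<close>)
  qed
  also have "\<dots> \<le> k" using assms(1) by (simp add: dfs_def)
  finally have *: "card X * (2 * (n - card V)) \<le> k" .
  have "card V \<le> card V0 + 32 * w"
    using dfs_card_seen [OF assms(1,2)] assms(3) by (simp add: V_def)
  then have "real (card X) * 1 \<le> card X * (real (2 * (n - card V)) * r)"
    using room_fresh(2) by (intro mult_left_mono) auto
  also have "\<dots> = real (card X * (2 * (n - card V))) * r"
    by (simp only: of_nat_mult [of "card X"] mult.assoc)
  also have "\<dots> \<le> k * r" using r_pos by (intro mult_right_mono of_nat_mono *) auto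
  finally show ?thesis by simp
qed

text \<open>Here \<open>pos\<close> counts the positive answers so far and \<open>m\<close> those since the bottom part \<open>B\<close> of the
  stack was singled out; \<open>D\<close> consists of the literals discovered above \<open>B\<close>.\<close>
definition search_state ::
    "literal list \<Rightarrow> nat \<Rightarrow> nat \<Rightarrow> nat \<Rightarrow> formula \<Rightarrow> formula \<Rightarrow> literal list \<Rightarrow> literal set \<Rightarrow> literal set \<Rightarrow> bool" where
  "search_state B k pos m K P st T D \<longleftrightarrow>
    dfs k K P (st @ B) T \<and> pos \<le> length (st @ B) + card T \<and> length (st @ B) \<le> pos + 1 \<and>
    (B \<noteq> [] \<longrightarrow> set st \<subseteq> D \<and> D \<subseteq> set st \<union> T \<and> m \<le> card D \<and>
      (\<forall>y\<in>D. path_within (implication_digraph n P) (insert (hd B) D) (hd B) y))"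

definition search :: "literal list \<Rightarrow> nat \<Rightarrow> nat \<Rightarrow> nat \<Rightarrow> formula \<Rightarrow> formula \<Rightarrow> bool" where
  "search B k pos m K P \<longleftrightarrow> (\<exists>st T D. search_state B k pos m K P st T D)"

lemma dfs_pop:
  assumes "dfs k K P (x # st) T" "k * r \<le> 3 * w" "length (x # st) \<le> 29 * w"
    and "\<forall>y\<in>literals n. lit_var y \<notin> seen (set (x # st) \<union> T) \<longrightarrow> edge x y \<in> K"
  shows "dfs k K P st (insert x T)" "card (insert x T) = card T + 1"
proof -
  have "set (x # st) \<union> T = set st \<union> insert x T" by auto
  moreover have "real (card (insert x T)) \<le> k * r"
    by (rule dfs_exhausted_card [OF assms(1-3)]) (use assms(1,4) in \<open>auto simp: dfs_def\<close>)
  ultimately show "dfs k K P st (insert x T)"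
    using assms(1,4) by (auto simp: dfs_def successively_Cons)
  show "card (insert x T) = card T + 1"
    using assms(1) dfs_finite [OF assms(1)] by (auto simp: dfs_def)
qed

lemma dfs_new_root:
  assumes "dfs k K P [] T" "x \<in> literals n" "lit_var x \<notin> seen T"
  shows "dfs k K P [x] T"
proof -
  have "x \<notin> T" "lit_var x \<notin> lit_var ` T" "lit_var x \<notin> V0" using assms(3) by (auto simp: seen_def)
  moreover have *: "K \<subseteq> K0 \<union> out_edges n (insert x T)"
    using assms(1) out_edges_mono [OF subset_insertI [of T x], of n] unfolding dfs_def by auto
  ultimately show ?thesis
    using assms unfolding dfs_def by (auto simp: seen_def)
qed

text \<open>Exhausted tops are popped until a fresh query appears; without a spine, an empty stack
  gets a new root. The spine is never popped: exhausting its top would give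
  \<open>card T + 1 \<le> k * r\<close>, and with \<open>pos \<le> length B + card T\<close> this
  contradicts the bound on \<open>length B\<close>.\<close>

lemma search_normalise:
  assumes "search_state B k pos m K P st T D" "k * r \<le> 3 * w" "pos \<le> 16 * w"
    and "B \<noteq> [] \<Longrightarrow> length B < pos - k * r + 1"
  shows "\<exists>st T D y. search_state B k pos m K P st T D \<and> st @ B \<noteq> [] \<and> y \<in> literals n \<and>
    lit_var y \<notin> seen (set (st @ B) \<union> T) \<and> edge (hd (st @ B)) y \<notin> K"
  using assms(1)
proof (induction "length st" arbitrary: st T)
  case 0
  then have [simp]: "st = []" by simp
  have dfs: "dfs k K P B T" and len: "pos \<le> length B + card T" "length B \<le> pos + 1"
    using 0 by (auto simp: search_state_def)
  have len': "length B \<le> 29 * w" using len assms(3) w by linarith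
  show ?case
  proof (cases "B = []")
    case True
    \<comment> \<open>Two unseen variables are needed, one for the root \<open>x\<close> and one for
      its first query target \<open>y\<close>.\<close>
    have seenT: "card (seen T) \<le> card V0 + 3 * w"
      using dfs_card_seen [OF dfs assms(2)] True by simp
    have TV: "seen T \<subseteq> {1..n}" using dfs True by (intro seen_subset) (simp add: dfs_def)
    have "card (seen T) < n" by (rule room_fresh) (use seenT in simp)
    then have "0 < card {y \<in> literals n. lit_var y \<notin> seen T}"
      using card_fresh_literals [OF TV] by simp
    then obtain x where x: "x \<in> literals n" "lit_var x \<notin> seen T"
      by (metis (no_types, lifting) card.empty equals0I less_nat_zero_code mem_Collect_eq)
    have X: "seen (insert x T) \<subseteq> {1..n}"
      using dfs True x by (intro seen_subset) (simp add: dfs_def)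
    have "card (seen (insert x T)) \<le> card (seen T) + 1"
      by (simp add: seen_def card_insert_if dfs_finite [OF dfs] finite_V0)
    then have "card (seen (insert x T)) < n"
      using seenT w by (intro room_fresh) simp
    then have "0 < card {y \<in> literals n. lit_var y \<notin> seen (insert x T)}"
      using card_fresh_literals [OF X] by simp
    then obtain y where y: "y \<in> literals n" "lit_var y \<notin> seen (insert x T)"
      by (metis (no_types, lifting) card.empty equals0I less_nat_zero_code mem_Collect_eq)
    have "dfs k K P [x] T" using dfs_new_root dfs x True by simp
    then have "search_state B k pos m K P [x] T D"
      using True len by (simp add: search_state_def)
    moreover have "edge x y \<notin> K"
    proof
      assume "edge x y \<in> K"
      moreover have "lit_var x \<notin> V0" "lit_var y \<notin> V0" using x y by (auto simp: seen_def)
      then have "edge x y \<notin> K0" by (rule fresh_not_in_K0)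
      ultimately obtain x' y' where e: "edge x y = edge x' y'" "x' \<in> T"
        using dfs True by (auto simp: dfs_def out_edges_def)
      then have "x' = x"
        using y by (subst (asm) eq_commute, intro conjunct1 [OF edge_eqD, symmetric]) (auto simp: seen_def)
      then show False using e x by (auto simp: seen_def)
    qed
    ultimately show ?thesis
      using True y by (intro exI [of _ "[x]"] exI [of _ T] exI [of _ D] exI [of _ y]) simp
  next
    case False
    then obtain x B' where B: "B = x # B'" by (cases B) auto
    have "\<exists>y\<in>literals n. lit_var y \<notin> seen (set B \<union> T) \<and> edge x y \<notin> K"
    proof (rule ccontr)
      assume "\<not> ?thesis"
      then have "dfs k K P B' (insert x T)" "card (insert x T) = card T + 1"
        using dfs_pop [of k K P x B' T] dfs assms(2) len' unfolding B by auto
      then have "real (card T + 1) \<le> k * r" by (simp add: dfs_def)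
      then show False using assms(4) [OF False] len by linarith
    qed
    then show ?thesis
      using 0 B by (intro exI [of _ "[]"] exI [of _ T] exI [of _ D]) auto
  qed
next
  case (Suc l)
  then obtain x st' where st: "st = x # st'" by (cases st) auto
  have dfs: "dfs k K P (x # st' @ B) T" and len: "length (st @ B) \<le> pos + 1"
    using Suc.prems st by (auto simp: search_state_def)
  show ?case
  proof (cases "\<exists>y\<in>literals n. lit_var y \<notin> seen (set (st @ B) \<union> T) \<and> edge x y \<notin> K")
    case True
    then show ?thesis
      using Suc.prems st by (intro exI [of _ st] exI [of _ T] exI [of _ D]) auto
  next
    case False
    have len': "length (x # st' @ B) \<le> 29 * w" using len assms(3) w st by simp
    have "dfs k K P (st' @ B) (insert x T)" "card (insert x T) = card T + 1"
      using dfs_pop [OF dfs assms(2) len'] False st by auto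
    then have "search_state B k pos m K P st' (insert x T) D"
      using Suc.prems st by (auto simp: search_state_def)
    then show ?thesis using Suc.hyps st by simp
  qed
qed

lemma search_step:
  assumes "search B k pos m K P" "k * r \<le> 3 * w" "pos \<le> 16 * w"
    and "B \<noteq> [] \<Longrightarrow> length B < pos - k * r + 1"
  shows "\<exists>c\<in>clauses n - K. \<forall>b. search B (k + 1) (pos + of_bool b) (m + of_bool b)
    (insert c K) (if b then insert c P else P)"
proof -
  from assms search_normalise obtain st T D y where
    S: "search_state B k pos m K P st T D" and ne: "st @ B \<noteq> []" and y: "y \<in> literals n"
    "lit_var y \<notin> seen (set (st @ B) \<union> T)" and fresh: "edge (hd (st @ B)) y \<notin> K"
    unfolding search_def by metis
  define x where "x = hd (st @ B)"
  have dfs: "dfs k K P (st @ B) T" using S by (simp add: search_state_def)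
  have x: "x \<in> set (st @ B)" using ne by (simp add: x_def del: hd_append set_append)
  have xy: "lit_var x \<noteq> lit_var y" using x y unfolding seen_def by (metis UnCI imageI set_append)
  have finK: "finite K" using dfs_clauses [OF dfs] finite_clauses by (rule finite_subset)
  have c: "edge x y \<in> clauses n"
    using x y dfs xy by (intro edge_in_clauses) (auto simp: dfs_def)
  have card: "card (insert (edge x y) K - K0) \<le> k + 1"
  proof -
    have "card (insert (edge x y) K - K0) \<le> card (insert (edge x y) (K - K0))"
      using finK by (intro card_mono) auto
    also have "\<dots> \<le> card (K - K0) + 1"
      using finK by (simp add: card_insert_if)
    finally show ?thesis using dfs by (simp add: dfs_def)
  qed
  have T: "real (card T) \<le> (1 + real k) * r"
    using dfs r_pos by (simp add: dfs_def algebra_simps)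
  have no: "dfs (k + 1) (insert (edge x y) K) P (st @ B) T"
  proof -
    have "insert (edge x y) K \<subseteq> K0 \<union> out_edges n (set (st @ B) \<union> T)"
      using dfs out_edgesI [of x "set (st @ B) \<union> T" y] x y(1) xy unfolding dfs_def by blast
    then show ?thesis
      using dfs card T unfolding dfs_def by (auto simp: algebra_simps)
  qed
  define X where "X = set (st @ B) \<union> T"
  have yX: "y \<notin> X" "lit_var y \<notin> lit_var ` X" "lit_var y \<notin> V0"
    using y by (auto simp: seen_def X_def)
  have yes: "dfs (k + 1) (insert (edge x y) K) (insert (edge x y) P) (y # st @ B) T"
  proof -
    note no' = no [unfolded dfs_def, folded X_def]
    have eq: "set (y # st @ B) \<union> T = insert y X" by (simp add: X_def)
    have "out_edges n X \<subseteq> out_edges n (insert y X)" by (rule out_edges_mono) auto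
    moreover have "stack_path P (st @ B)" using no' by blast
    then have "stack_path (insert (edge x y) P) (st @ B)"
      by (rule successively_mono) auto
    moreover have "y \<notin> set (st @ B)" "y \<notin> T" using yX(1) by (simp_all add: X_def)
    ultimately show ?thesis
      unfolding dfs_def eq
      by (intro conjI) (use no' yX y(1) in \<open>auto simp: successively_Cons x_def seen_def\<close>)
  qed
  have "search_state B (k + 1) (pos + 1) (m + 1) (insert (edge x y) K) (insert (edge x y) P) (y # st) T (insert y D)"
    unfolding search_state_def
  proof (intro conjI impI)
    assume "B \<noteq> []"
    with S have D: "set st \<subseteq> D" "D \<subseteq> set st \<union> T" "m \<le> card D"
      "\<And>z. z \<in> D \<Longrightarrow> path_within (implication_digraph n P) (insert (hd B) D) (hd B) z"
      by (auto simp: search_state_def)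
    have finD: "finite D" using D(2) dfs_finite [OF dfs] finite_subset by auto
    have "hd B \<in> set B" using \<open>B \<noteq> []\<close> by simp
    have yD: "y \<notin> D" "y \<noteq> hd B" using D(2) yX(1) X_def \<open>hd B \<in> set B\<close> by auto
    show "set (y # st) \<subseteq> insert y D" using D by auto
    show "insert y D \<subseteq> set (y # st) \<union> T" using D by auto
    show "m + 1 \<le> card (insert y D)" using D finD yD by simp
    \<comment> \<open>The query leaves from the junction \<open>hd B\<close> if nothing lies above
      the spine, and from a literal of \<open>D\<close> otherwise; either way a positive answer
      extends a path from \<open>hd B\<close>.\<close>
    have xD: "x = hd B \<or> x \<in> D"
      using D(1) by (cases st) (auto simp: x_def)
    have "hd B \<in> literals n" using \<open>hd B \<in> set B\<close> dfs by (auto simp: dfs_def)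
    then have "path_within (implication_digraph n P) (insert (hd B) D) (hd B) x"
      using xD D(4) by (auto intro: path_within_refl)
    then have "path_within (implication_digraph n (insert (edge x y) P)) (insert (hd B) D) (hd B) x"
      by (rule path_within_mono) auto
    then have "path_within (implication_digraph n (insert (edge x y) P)) (insert y (insert (hd B) D)) (hd B) y"
      using yD y by (intro path_within_snoc [where x = x]) auto
    then show "\<forall>z\<in>insert y D. path_within (implication_digraph n (insert (edge x y) P)) (insert (hd B) (insert y D)) (hd B) z"
      by (auto simp: insert_commute intro: path_within_mono [OF D(4)])
  qed (use S yes in \<open>auto simp: search_state_def\<close>)
  moreover have "search_state B (k + 1) pos m (insert (edge x y) K) P st T D"
    using S no by (auto simp: search_state_def)
  ultimately have "search B (k + 1) (pos + of_bool b) (m + of_bool b)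
    (insert (edge x y) K) (if b then insert (edge x y) P else P)" for b
    unfolding search_def by (cases b) auto
  then show ?thesis using c fresh x_def by blast
qed

text \<open>What a block hands on whether or not it succeeds: the conditions that the locale puts on
  the past, for the enlarged touched set \<open>V\<close>.\<close>

definition knows :: "nat set \<Rightarrow> formula \<Rightarrow> formula \<Rightarrow> bool" where
  "knows V K P \<longleftrightarrow> V0 \<subseteq> V \<and> V \<subseteq> {1..n} \<and> card V \<le> card V0 + 32 * w \<and> K \<subseteq> clauses n \<and>
    (\<forall>c\<in>K. \<exists>z\<in>c. lit_var z \<in> V) \<and> P0 \<subseteq> P \<and> P \<subseteq> K"

lemma dfs_touched:
  assumes "dfs k K P st T" "c \<in> K"
  shows "\<exists>z\<in>c. lit_var z \<in> seen (set st \<union> T)"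
proof -
  have "c \<in> K0 \<or> c \<in> out_edges n (set st \<union> T)" using assms by (auto simp: dfs_def)
  then show ?thesis
  proof
    assume "c \<in> K0"
    then show ?thesis using K0_touched by (auto simp: seen_def)
  next
    assume "c \<in> out_edges n (set st \<union> T)"
    then obtain x y where "c = edge x y" "x \<in> set st \<union> T" by (auto simp: out_edges_def)
    then show ?thesis by (auto simp: seen_def intro!: bexI [of _ "negate x"])
  qed
qed

lemma search_knows:
  assumes "search B k pos m K P" "k * r \<le> 3 * w" "pos \<le> 16 * w + 1"
  shows "\<exists>V. knows V K P"
proof -
  from assms(1) obtain st T where dfs: "dfs k K P (st @ B) T" and len: "length (st @ B) \<le> pos + 1"
    by (auto simp: search_def search_state_def)
  have "card (seen (set (st @ B) \<union> T)) \<le> card V0 + 32 * w"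
    using dfs_card_seen [OF dfs assms(2)] len assms(3) w by linarith
  moreover have "seen (set (st @ B) \<union> T) \<subseteq> {1..n}"
    using dfs by (intro seen_subset) (simp add: dfs_def)
  ultimately have "knows (seen (set (st @ B) \<union> T)) K P"
    using dfs_clauses [OF dfs] dfs_touched [OF dfs] dfs by (auto simp: knows_def dfs_def seen_def)
  then show ?thesis by blast
qed

subsection \<open>Backward search from the spine\<close>

text \<open>A snapshot after the forward search: \<open>hd B\<close> will be the centre of the
  hourglass and \<open>D\<close> its out-portion. The last conjunct guarantees the backward search
  fresh queries into \<open>B\<close>.\<close>

definition spine :: "nat set \<Rightarrow> formula \<Rightarrow> formula \<Rightarrow> literal list \<Rightarrow> literal set \<Rightarrow> bool" where
  "spine V1 K1 P1 B D \<longleftrightarrow>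
    V0 \<subseteq> V1 \<and> V1 \<subseteq> {1..n} \<and> card V1 \<le> card V0 + 22 * w \<and> K1 \<subseteq> clauses n \<and>
    (\<forall>c\<in>K1. \<exists>z\<in>c. lit_var z \<in> V1) \<and> P0 \<subseteq> P1 \<and> P1 \<subseteq> K1 \<and>
    B \<noteq> [] \<and> distinct B \<and> set B \<union> D \<subseteq> literals n \<and> inj_on lit_var (set B \<union> D) \<and> set B \<inter> D = {} \<and>
    lit_var ` (set B \<union> D) \<subseteq> V1 - V0 \<and> stack_path P1 B \<and>
    (\<forall>y\<in>D. path_within (implication_digraph n P1) (insert (hd B) D) (hd B) y) \<and>
    (\<forall>x\<in>set B. \<forall>y\<in>literals n. lit_var y \<notin> V1 \<longrightarrow> edge y x \<notin> K1)"

text \<open>Beyond \<open>K0\<close>, only out-edges of explored literals were revealed. An arc into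
  \<open>x\<close> in \<open>B\<close> from an unseen variable could be among them only as a
  contrapositive, that is as an out-edge of \<open>negate x\<close>; but explored literals have
  distinct variables, so \<open>negate x\<close> is not explored.\<close>

lemma search_spine:
  assumes "search B k pos m K P" "B \<noteq> []" "k * r \<le> 3 * w" "pos \<le> 16 * w"
  shows "\<exists>V1 D. spine V1 K P B D \<and> m \<le> card D"
proof -
  from assms(1) obtain st T D where S: "search_state B k pos m K P st T D"
    by (auto simp: search_def)
  define X where "X = set (st @ B) \<union> T"
  from S assms(2) have dfs: "dfs k K P (st @ B) T" and len: "length (st @ B) \<le> pos + 1"
    and D: "D \<subseteq> set st \<union> T" "m \<le> card D"
    "\<forall>y\<in>D. path_within (implication_digraph n P) (insert (hd B) D) (hd B) y"
    by (auto simp: search_state_def)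
  note dfs' = dfs [unfolded dfs_def, folded X_def]
  have sub: "set B \<union> D \<subseteq> X" using D(1) by (auto simp: X_def)
  have disj: "set B \<inter> D = {}" using dfs' D(1) by auto
  have X: "X \<subseteq> literals n" "inj_on lit_var X" "lit_var ` X \<inter> V0 = {}" using dfs' by auto
  have "edge y x \<notin> K" if x: "x \<in> set B" and y: "y \<in> literals n" "lit_var y \<notin> seen X" for x y
  proof
    assume "edge y x \<in> K"
    have "lit_var x \<notin> V0" "lit_var y \<notin> V0" using x y X(3) sub by (auto simp: seen_def)
    then have "edge y x \<notin> K0" by (intro fresh_not_in_K0)
    then obtain x' y' where e: "edge y x = edge x' y'" "x' \<in> X"
      using \<open>edge y x \<in> K\<close> dfs' by (auto simp: out_edges_def)
    then have "lit_var y \<noteq> lit_var x'" using y by (auto simp: seen_def)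
    then have "negate y \<noteq> negate x'" by (metis lit_var_negate)
    with e(1) have "x = negate x'" by (auto simp: doubleton_eq_iff)
    moreover have "x = x'"
      using X(2) x sub e(2) calculation by (intro inj_onD [of lit_var X]) auto
    ultimately show False by (cases x') auto
  qed
  \<comment> \<open>At most \<open>16 * w + 1\<close> literals on the stack and \<open>3 * w\<close>
    exhausted ones; the rest is slack.\<close>
  moreover have "card (seen X) \<le> card V0 + 22 * w"
    using dfs_card_seen [OF dfs assms(3)] len assms(4) w by (simp add: X_def)
  moreover have "stack_path P B" using dfs' by (simp add: successively_append_iff)
  moreover have "seen X \<subseteq> {1..n}" using X seen_subset by blast
  moreover have "inj_on lit_var (set B \<union> D)" using X(2) sub by (rule inj_on_subset)
  moreover have "lit_var ` (set B \<union> D) \<subseteq> seen X - V0" using sub X(3) by (auto simp: seen_def)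
  moreover have "\<forall>c\<in>K. \<exists>z\<in>c. lit_var z \<in> seen X" using dfs_touched [OF dfs] by (simp add: X_def)
  moreover have "V0 \<subseteq> seen X" by (auto simp: seen_def)
  moreover have "set B \<union> D \<subseteq> literals n" using sub X(1) by blast
  moreover have "distinct B" "P0 \<subseteq> P" "P \<subseteq> K" using dfs' by auto
  ultimately have "spine (seen X) K P B D"
    using disj assms(2) D(3) dfs_clauses [OF dfs] unfolding spine_def by blast
  then show ?thesis using D(2) by blast
qed

text \<open>\<open>R\<close> collects the literals found to lead to \<open>hd B\<close>. Arcs into
  \<open>R\<close> are, as clauses, out-edges of the negations of \<open>R\<close>. No stack is
  kept: only the size of \<open>R\<close> matters, and paths may run through all of
  \<open>R\<close>.\<close>

definition inflow ::
    "nat set \<Rightarrow> formula \<Rightarrow> formula \<Rightarrow> literal list \<Rightarrow> nat \<Rightarrow> nat \<Rightarrow> formula \<Rightarrow> formula \<Rightarrow> literal set \<Rightarrow> bool" where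
  "inflow V1 K1 P1 B k pos K P R \<longleftrightarrow>
    set B \<subseteq> R \<and> R \<subseteq> literals n \<and> inj_on lit_var R \<and> lit_var ` (R - set B) \<inter> V1 = {} \<and>
    K1 \<subseteq> K \<and> K \<subseteq> K1 \<union> out_edges n (negate ` R) \<and> P1 \<subseteq> P \<and> P \<subseteq> K \<and> card (K - K1) \<le> k \<and>
    (\<forall>x\<in>R. path_within (implication_digraph n P) R x (hd B)) \<and> card R = length B + pos"

lemma inflow_init:
  assumes "spine V1 K1 P1 B D"
  shows "inflow V1 K1 P1 B 0 0 K1 P1 (set B)"
  using assms unfolding inflow_def spine_def
  by (auto simp: distinct_card intro: stack_path_to_hd inj_on_subset)

lemma inflow_card:
  assumes "spine V1 K1 P1 B D" "inflow V1 K1 P1 B k pos K P R"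
  shows "finite R" "card (V1 \<union> lit_var ` R) \<le> card V1 + pos" "V1 \<union> lit_var ` R \<subseteq> {1..n}"
proof -
  show R: "finite R" using assms(2) finite_subset [OF _ finite_literals] by (auto simp: inflow_def)
  have V1: "V1 \<subseteq> {1..n}" "lit_var ` set B \<subseteq> V1" using assms(1) by (auto simp: spine_def)
  then show "V1 \<union> lit_var ` R \<subseteq> {1..n}"
    using assms(2) by (auto simp: inflow_def in_literals_iff subset_iff)
  have "V1 \<union> lit_var ` R = V1 \<union> lit_var ` (R - set B)" using V1(2) by auto
  also have "card \<dots> \<le> card V1 + card (R - set B)"
    using R by (meson add_left_mono card_Un_le card_image_le finite_Diff order_trans)
  also have "card (R - set B) = pos"
    using assms R by (subst card_Diff_subset) (auto simp: inflow_def spine_def distinct_card)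
  finally show "card (V1 \<union> lit_var ` R) \<le> card V1 + pos" .
qed

lemma inflow_clauses:
  assumes "spine V1 K1 P1 B D" "inflow V1 K1 P1 B k pos K P R"
  shows "K \<subseteq> clauses n"
proof -
  have "negate ` R \<subseteq> literals n" using assms(2) by (auto simp: inflow_def in_literals_iff)
  then have "out_edges n (negate ` R) \<subseteq> clauses n" by (rule out_edges_subset_clauses)
  then show ?thesis using assms by (auto simp: inflow_def spine_def)
qed

lemma inflow_knows:
  assumes "spine V1 K1 P1 B D" "inflow V1 K1 P1 B k pos K P R" "pos \<le> 8 * w + 1"
  shows "knows (V1 \<union> lit_var ` R) K P"
proof -
  have "\<exists>z\<in>c. lit_var z \<in> V1 \<union> lit_var ` R" if "c \<in> K" for c
  proof -
    have "c \<in> K1 \<or> c \<in> out_edges n (negate ` R)" using that assms(2) by (auto simp: inflow_def)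
    then show ?thesis using assms(1) by (fastforce simp: spine_def out_edges_def)
  qed
  moreover have "card V1 \<le> card V0 + 22 * w" using assms(1) by (simp add: spine_def)
  then have "card (V1 \<union> lit_var ` R) \<le> card V0 + 32 * w"
    using inflow_card(2) [OF assms(1,2)] assms(3) w by linarith
  ultimately show ?thesis
    unfolding knows_def
    using inflow_card(3) [OF assms(1,2)] inflow_clauses [OF assms(1,2)] assms(1,2)
    by (auto simp: inflow_def spine_def)
qed

text \<open>If all arcs into \<open>R\<close> from unseen variables had been asked, the count of
  queries would force \<open>card R \<le> k * r\<close>, against \<open>alive\<close>. The spine is
  thus a head start that keeps the backward search from dying out.\<close>

lemma inflow_step:
  assumes spine: "spine V1 K1 P1 B D" and inflow: "inflow V1 K1 P1 B k pos K P R"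
    and "pos \<le> 8 * w" and alive: "k * r < length B + pos"
  shows "\<exists>c\<in>clauses n - K. \<forall>b. \<exists>R'. inflow V1 K1 P1 B (k + 1) (pos + of_bool b)
    (insert c K) (if b then insert c P else P) R'"
proof -
  define V where "V = V1 \<union> lit_var ` R"
  have V: "card V \<le> card V0 + 32 * w" "V \<subseteq> {1..n}"
    using inflow_knows [OF spine inflow] assms(3) by (auto simp: V_def knows_def)
  have finR: "finite R" using inflow_card [OF spine inflow] by simp
  have finK: "finite K" using inflow_clauses [OF spine inflow] finite_clauses by (rule finite_subset)
  note inflow' = inflow [unfolded inflow_def]
  have "\<exists>x\<in>R. \<exists>y\<in>literals n. lit_var y \<notin> V \<and> edge y x \<notin> K"
  proof (rule ccontr)
    assume none: "\<not> ?thesis"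
    have "card R * (2 * (n - card V)) \<le> card (K - K1)"
    proof (rule card_times_fresh_le [OF _ V(2) finR])
      show "finite (K - K1)" using finK by simp
      show "(\<lambda>(x, y). edge y x) (x, y) \<in> K - K1" if x: "x \<in> R" and y: "y \<in> literals n" "lit_var y \<notin> V" for x y
      proof -
        \<comment> \<open>For \<open>x\<close> on the spine this is the last conjunct of
          \<open>spine\<close>; for any other \<open>x\<close> both variables lie outside
          \<open>V1\<close>, while every clause of \<open>K1\<close> touches
          \<open>V1\<close>.\<close>
        have "edge y x \<notin> K1"
        proof (cases "x \<in> set B")
          case True
          then show ?thesis using spine y by (auto simp: spine_def V_def)
        next
          case False
          then have "lit_var x \<notin> V1" using x inflow' by blast
          moreover have "lit_var y \<notin> V1" using y by (simp add: V_def)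
          ultimately show ?thesis using spine by (fastforce simp: spine_def)
        qed
        then show ?thesis using none x y by auto
      qed
      show "inj_on (\<lambda>(x, y). edge y x) (R \<times> {y \<in> literals n. lit_var y \<notin> V})"
      proof (rule inj_onI, clarify)
        fix x y x' y' assume *: "edge y x = edge y' x'" "x' \<in> R" "lit_var y \<notin> V"
        then have "lit_var y \<noteq> lit_var x'" by (auto simp: V_def)
        from edge_eq_swapD [OF *(1) this] show "x = x' \<and> y = y'" by simp
      qed
    qed
    also have "\<dots> \<le> k" using inflow' by simp
    finally have *: "card R * (2 * (n - card V)) \<le> k" .
    have "real (card R) * 1 \<le> card R * (real (2 * (n - card V)) * r)"
      by (rule mult_left_mono [OF room_fresh(2) [OF V(1)]]) simp
    also have "\<dots> = real (card R * (2 * (n - card V))) * r"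
      by (simp only: of_nat_mult [of "card R"] mult.assoc)
    also have "\<dots> \<le> k * r" using r_pos by (intro mult_right_mono of_nat_mono *) auto
    finally show False using alive inflow' by simp
  qed
  then obtain x y where x: "x \<in> R" and y: "y \<in> literals n" "lit_var y \<notin> V" and fresh: "edge y x \<notin> K"
    by blast
  have xy: "lit_var y \<noteq> lit_var x" using x y by (auto simp: V_def)
  have c: "edge y x \<in> clauses n" using x y xy inflow' by (intro edge_in_clauses) auto
  have cR: "edge y x \<in> out_edges n (negate ` R)"
  proof -
    have "edge (negate x) (negate y) \<in> out_edges n (negate ` R)"
      using x y xy by (intro out_edgesI) (auto simp: in_literals_iff)
    then show ?thesis by (simp add: insert_commute)
  qed
  have card: "card (insert (edge y x) K - K1) \<le> k + 1"
  proof -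
    have "card (insert (edge y x) K - K1) \<le> card (insert (edge y x) (K - K1))"
      using finK by (intro card_mono) auto
    also have "\<dots> \<le> card (K - K1) + 1"
      using finK by (simp add: card_insert_if)
    finally show ?thesis using inflow' by simp
  qed
  have no: "inflow V1 K1 P1 B (k + 1) pos (insert (edge y x) K) P R"
    using inflow' card cR unfolding inflow_def by blast
  have yes: "inflow V1 K1 P1 B (k + 1) (pos + 1) (insert (edge y x) K) (insert (edge y x) P) (insert y R)"
    unfolding inflow_def
  proof (intro conjI)
    have yR: "y \<notin> R" "lit_var y \<notin> lit_var ` R" "lit_var y \<notin> V1" using y by (auto simp: V_def)
    have "out_edges n (negate ` R) \<subseteq> out_edges n (negate ` insert y R)" by (rule out_edges_mono) auto
    then show "insert (edge y x) K \<subseteq> K1 \<union> out_edges n (negate ` insert y R)"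
      using inflow' cR by blast
    have "card R = length B + pos" using inflow' by blast
    then show "card (insert y R) = length B + (pos + 1)" using yR finR by simp
    have "path_within (implication_digraph n (insert (edge y x) P)) R x (hd B)"
    proof (rule path_within_mono)
      show "path_within (implication_digraph n P) R x (hd B)" using inflow' x by blast
    qed auto
    then have "path_within (implication_digraph n (insert (edge y x) P)) (insert y R) y (hd B)"
      using yR y by (intro path_within_Cons [where x = x]) auto
    moreover have "path_within (implication_digraph n (insert (edge y x) P)) (insert y R) z (hd B)" if "z \<in> R" for z
    proof (rule path_within_mono)
      show "path_within (implication_digraph n P) R z (hd B)" using inflow' that by blast
    qed auto
    ultimately show "\<forall>z\<in>insert y R. path_within (implication_digraph n (insert (edge y x) P)) (insert y R) z (hd B)"
      by blast
    have "lit_var ` (R - set B) \<inter> V1 = {}" using inflow' by blast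
    then show "lit_var ` (insert y R - set B) \<inter> V1 = {}" using yR(3) by auto
    have "inj_on lit_var R" using inflow' by (elim conjE)
    then show "inj_on lit_var (insert y R)" using yR(1,2) by (simp add: inj_on_insert)
    have "R \<subseteq> literals n" "set B \<subseteq> R" "K1 \<subseteq> K" "P1 \<subseteq> P" "P \<subseteq> K" using inflow' by simp_all
    then show "insert y R \<subseteq> literals n" "set B \<subseteq> insert y R" "K1 \<subseteq> insert (edge y x) K"
      "P1 \<subseteq> insert (edge y x) P" "insert (edge y x) P \<subseteq> insert (edge y x) K"
      using y(1) by auto
  qed (rule card)
  show ?thesis
  proof (intro bexI [of _ "edge y x"] allI)
    fix b
    show "\<exists>R'. inflow V1 K1 P1 B (k + 1) (pos + of_bool b) (insert (edge y x) K)
        (if b then insert (edge y x) P else P) R'"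
      using yes no by (cases b) auto
  qed (use c fresh in auto)
qed

definition hourglass_found :: "nat set \<Rightarrow> formula \<Rightarrow> bool" where
  "hourglass_found V P \<longleftrightarrow> (\<exists>h. is_hourglass (implication_digraph n P) h \<and>
    lit_var ` hourglass_verts h \<subseteq> V - V0 \<and>
    card (in_portion h) \<in> {w..32 * w} \<and> card (out_portion h) \<in> {w..32 * w})"

text \<open>The hourglass has centre \<open>hd B\<close>, in-portion \<open>R\<close> without the
  centre, and out-portion \<open>D\<close>. Spine and \<open>D\<close> live on variables of
  \<open>V1\<close>, the rest of \<open>R\<close> on other variables, whence strict distinctness.
  The upper bounds on the sizes count all variables touched in the block.\<close>

lemma inflow_hourglass:
  assumes spine: "spine V1 K1 P1 B D" and inflow: "inflow V1 K1 P1 B k pos K P R" and "pos \<le> 8 * w"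
    and w: "w < card R" "w \<le> card D"
  shows "hourglass_found (V1 \<union> lit_var ` R) P"
proof -
  define v where "v = hd B"
  define V where "V = V1 \<union> lit_var ` R"
  note inflow' = inflow [unfolded inflow_def] and spine' = spine [unfolded spine_def]
  have V: "V0 \<subseteq> V" "card V \<le> card V0 + 32 * w" "V \<subseteq> {1..n}"
    using inflow_knows [OF spine inflow] assms(3) by (auto simp: V_def knows_def)
  have finR: "finite R" using inflow_card [OF spine inflow] by simp
  have v: "v \<in> set B" "v \<in> R" using spine' inflow' by (auto simp: v_def)
  have RD: "R \<inter> D = {}"
  proof (rule ccontr)
    assume "R \<inter> D \<noteq> {}"
    then obtain x where "x \<in> R" "x \<in> D" by blast
    then have "x \<in> R - set B" "lit_var x \<in> V1" using spine' by auto
    then show False using inflow' by blast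
  qed
  have inj: "inj_on lit_var (R \<union> D)"
  proof -
    have "R \<union> D = (R - set B) \<union> (set B \<union> D)" using inflow' by blast
    moreover have "inj_on lit_var ((R - set B) \<union> (set B \<union> D))"
    proof (subst inj_on_Un, intro conjI)
      show "inj_on lit_var (R - set B)" using inflow' by (meson Diff_subset inj_on_subset)
      show "inj_on lit_var (set B \<union> D)" using spine' by blast
      have "lit_var ` (set B \<union> D) \<subseteq> V1" "lit_var ` (R - set B) \<inter> V1 = {}"
        using spine' inflow' by blast+
      then show "lit_var ` (R - set B - (set B \<union> D)) \<inter> lit_var ` (set B \<union> D - (R - set B)) = {}"
        by blast
    qed
    ultimately show ?thesis by simp
  qed
  have RDV: "lit_var ` (R \<union> D) \<subseteq> V - V0"
  proof -
    have *: "lit_var ` (set B \<union> D) \<subseteq> V1 - V0" using spine' by (elim conjE)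
    have V01: "V0 \<subseteq> V1" using spine' by (elim conjE)
    have **: "lit_var ` (R - set B) \<inter> V1 = {}" using inflow' by (elim conjE)
    have "lit_var ` (R \<union> D) \<subseteq> lit_var ` (R - set B) \<union> lit_var ` (set B \<union> D)" by blast
    also have "\<dots> \<subseteq> V - V0"
    proof (rule Un_least)
      have "lit_var ` (R - set B) \<inter> V0 \<subseteq> lit_var ` (R - set B) \<inter> V1"
        by (rule Int_mono [OF order_refl V01])
      then have "lit_var ` (R - set B) \<inter> V0 = {}" using ** by simp
      moreover have "lit_var ` (R - set B) \<subseteq> V" unfolding V_def by blast
      ultimately show "lit_var ` (R - set B) \<subseteq> V - V0" by blast
      show "lit_var ` (set B \<union> D) \<subseteq> V - V0" using * unfolding V_def by blast
    qed
    finally show ?thesis .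
  qed
  have finV: "finite V" using V(3) finite_subset by auto
  have small: "card X \<le> 32 * w" if "X \<subseteq> R \<union> D" for X
  proof -
    have "card X = card (lit_var ` X)"
      using inj that by (metis card_image inj_on_subset)
    also have "\<dots> \<le> card (V - V0)"
      using RDV that finV by (intro card_mono) auto
    also have "\<dots> = card V - card V0" using V finite_V0 by (simp add: card_Diff_subset)
    finally show ?thesis using V(2) by linarith
  qed
  have "is_hourglass (implication_digraph n P) (v, R - {v}, D)"
    unfolding is_hourglass.simps
  proof (intro conjI ballI)
    have "insert v (R - {v} \<union> D) = R \<union> D" using v by auto
    then show "strictly_distinct_set (insert v (R - {v} \<union> D))"
      using inj by (auto simp: strictly_distinct_set_def pairwise_def strictly_distinct_iff inj_on_def)
    show "path_within (implication_digraph n P) (insert v D) v y" if "y \<in> D" for y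
    proof (rule path_within_mono)
      show "path_within (implication_digraph n P1) (insert v D) v y" using spine' that v_def by blast
      show "P1 \<subseteq> P" using inflow' by blast
    qed auto
    show "path_within (implication_digraph n P) (insert v (R - {v})) x v" if "x \<in> R - {v}" for x
      using inflow' that v by (simp add: v_def insert_absorb)
    have "R \<subseteq> literals n" using inflow' by (elim conjE)
    moreover have "set B \<union> D \<subseteq> literals n" using spine' by (elim conjE)
    ultimately have "v \<in> literals n" "R \<subseteq> literals n" "D \<subseteq> literals n" "v \<notin> D"
      using v RD by auto
    then show "v \<in> verts (implication_digraph n P)" "R - {v} \<subseteq> verts (implication_digraph n P)"
      "D \<subseteq> verts (implication_digraph n P)" "v \<notin> D"
      by auto
  qed (use RD in auto)
  moreover have "lit_var ` hourglass_verts (v, R - {v}, D) \<subseteq> V - V0"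
    using RDV v by auto
  moreover have "card (R - {v}) \<in> {w..32 * w}"
    using w v finR small [of "R - {v}"] by auto
  moreover have "card D \<in> {w..32 * w}"
    using w small [of D] by auto
  ultimately show ?thesis
    unfolding hourglass_found_def V_def by (intro exI [of _ "(v, R - {v}, D)"]) simp
qed

end

subsection \<open>One block of coins\<close>

text \<open>\<open>\<tau> * w / 16\<close> is the tolerated deficit of the walk. The cap
  \<open>8 * w\<close>, well above the mean (1 + \<tau>)w for 2nw coins, only limits the number of
  touched variables.\<close>

definition steady :: "nat \<Rightarrow> real \<Rightarrow> nat \<Rightarrow> bool list set" where
  "steady n \<tau> w = {l. (\<forall>q\<le>length l. (1 + \<tau> / 2) / (2 * n) * q - \<tau> * w / 16 \<le> heads (take q l)) \<and>
    heads l \<le> 8 * w}"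

text \<open>Three consecutive steady pieces, nested so that \<open>prob_coins_add\<close> applies
  twice.\<close>

definition good :: "nat \<Rightarrow> real \<Rightarrow> nat \<Rightarrow> bool list set" where
  "good n \<tau> w = {l. take (2 * n * w) l \<in> steady n \<tau> w \<and> drop (2 * n * w) l \<in>
    {l. take (2 * n * w) l \<in> steady n \<tau> w \<and> drop (2 * n * w) l \<in> steady n \<tau> w}}"

lemma steady_prefix: "l @ [b] \<in> steady n \<tau> w \<Longrightarrow> l \<in> steady n \<tau> w"
  unfolding steady_def
proof (intro CollectI conjI allI impI)
  assume *: "l @ [b] \<in> {l. (\<forall>q\<le>length l. (1 + \<tau> / 2) / (2 * n) * q - \<tau> * w / 16 \<le> heads (take q l)) \<and>
    heads l \<le> 8 * w}"
  then show "heads l \<le> 8 * w" by simp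
  fix q assume "q \<le> length l"
  then have "q \<le> length (l @ [b])" by simp
  with * have "(1 + \<tau> / 2) / (2 * n) * q - \<tau> * w / 16 \<le> heads (take q (l @ [b]))" by blast
  then show "(1 + \<tau> / 2) / (2 * n) * q - \<tau> * w / 16 \<le> heads (take q l)"
    using \<open>q \<le> length l\<close> by simp
qed

lemma steady_heads_ge:
  assumes "l \<in> steady n \<tau> w"
  shows "(1 + \<tau> / 2) / (2 * n) * length l - \<tau> * w / 16 \<le> heads l"
proof -
  have "(1 + \<tau> / 2) / (2 * n) * length l - \<tau> * w / 16 \<le> heads (take (length l) l)"
    using assms unfolding steady_def by blast
  then show ?thesis by simp
qed

lemma steady_heads_le: "l \<in> steady n \<tau> w \<Longrightarrow> heads l \<le> 8 * w"
  by (simp add: steady_def)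

context exploration
begin

definition N :: nat where "N = 2 * n * w"

text \<open>The length of the spine. The first third ends with a surplus of at least \<tau>w/4 -
  \<tau>w/16, and the second may lose \<tau>w/16, so \<tau>w/8 literals are safe; the backward
  search needs a head start larger than its own deficit \<tau>w/16.\<close>

definition h :: nat where "h = nat \<lceil>\<tau> * w / 8\<rceil>"

lemma h_bounds: "\<tau> * w / 8 \<le> h" "h < \<tau> * w / 8 + 1" "0 < h"
proof -
  have "0 < \<tau> * w / 8" using \<tau> w by simp
  then show "\<tau> * w / 8 \<le> h" "h < \<tau> * w / 8 + 1" "0 < h"
    unfolding h_def by linarith+
qed

lemma queries_le:
  assumes "k \<le> 2 * N"
  shows "k * r \<le> 3 * w"
proof -
  have "k * r \<le> real (2 * N) * r" using assms r_pos by (intro mult_right_mono) auto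
  also have "\<dots> = 2 * w * (1 + \<tau> / 4)" using n by (simp add: N_def r_def field_simps)
  also have "\<dots> \<le> 2 * w * (1 + 1 / 4)" using \<tau> by (intro mult_left_mono) auto
  finally show ?thesis by simp
qed

lemma steady_surplus:
  assumes "l \<in> steady n \<tau> w"
  shows "length l * r + \<tau> * length l / (8 * n) - \<tau> * w / 16 \<le> heads l"
proof -
  have "(1 + \<tau> / 2) / (2 * n) * length l = length l * r + \<tau> * length l / (8 * n)"
    using n by (simp add: r_def field_simps)
  then show ?thesis using steady_heads_ge [OF assms] by simp
qed

lemma N_surplus: "\<tau> * N / (8 * n) = \<tau> * w / 4"
  using n by (simp add: N_def)

lemma search_init: "search [] 0 0 0 K0 P0"
proof -
  have "dfs 0 K0 P0 [] {}" using P0 by (simp add: dfs_def)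
  then show ?thesis unfolding search_def search_state_def by (intro exI [of _ "[]"] exI [of _ "{}"]) simp
qed

lemma knows_init: "knows V0 K0 P0"
  using V0 K0 P0 K0_touched by (simp add: knows_def)

text \<open>The bottom \<open>j\<close> literals become the spine, and those above it start
  \<open>D\<close>. The counter restarts at 0, which is sound because it is only a lower bound for
  \<open>card D\<close>.\<close>

lemma search_split:
  assumes "search [] k pos m K P" "0 < j" "j < pos - k * r + 1"
  shows "\<exists>B. length B = j \<and> search B k pos 0 K P"
proof -
  from assms(1) obtain st T where dfs: "dfs k K P st T" and pos: "pos \<le> length st + card T"
    and len: "length st \<le> pos + 1"
    by (auto simp: search_def search_state_def)
  have "card T \<le> k * r" using dfs by (simp add: dfs_def)
  then have "real j < length st + 1" using pos assms(3) by linarith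
  then have j: "j \<le> length st" by linarith
  define st1 B where "st1 = take (length st - j) st" and "B = drop (length st - j) st"
  have st: "st = st1 @ B" and lenB: "length B = j" using j by (simp_all add: st1_def B_def)
  have "B \<noteq> []" using lenB assms(2) by auto
  then have "path_within (implication_digraph n P) (insert (hd B) (set st1)) (hd B) y" if "y \<in> set st1" for y
    using dfs that unfolding st dfs_def by (intro stack_path_from_hd) auto
  then have "search_state B k pos 0 K P st1 T (set st1)"
    using dfs pos len unfolding search_state_def st by auto
  then show ?thesis using lenB unfolding search_def by blast
qed

lemma explores_forward:
  "explores (clauses n) N K0 P0 (\<lambda>l K P. (\<exists>V. knows V K P) \<and>
    (l \<in> steady n \<tau> w \<longrightarrow> search [] (length l) (heads l) (heads l) K P))"
proof (rule explores_while)
  show "\<exists>V. knows V K0 P0" using knows_init by blast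
  show "search [] (length []) (heads []) (heads []) K0 P0" using search_init by simp
  fix l K P assume l: "length l < N" "l \<in> steady n \<tau> w" and S: "search [] (length l) (heads l) (heads l) K P"
  have pos: "heads l \<le> 16 * w" using steady_heads_le [OF l(2)] by simp
  have k: "length l * r \<le> 3 * w" "real (length l + 1) * r \<le> 3 * w" using l by (intro queries_le; simp)+
  obtain c where c: "c \<in> clauses n - K" and S': "\<And>b. search [] (length l + 1)
      (heads l + of_bool b) (heads l + of_bool b) (insert c K) (if b then insert c P else P)"
    using search_step [OF S k(1) pos] by auto
  have "\<exists>V. knows V (insert c K) (if b then insert c P else P)" for b
    by (rule search_knows [OF S' k(2)]) (use pos in \<open>cases b; simp\<close>)
  moreover have "search [] (length (l @ [b])) (heads (l @ [b])) (heads (l @ [b]))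
      (insert c K) (if b then insert c P else P)" for b
    using S' [of b] by (cases b) simp_all
  ultimately show "\<exists>c\<in>clauses n - K. \<forall>b. search [] (length (l @ [b])) (heads (l @ [b])) (heads (l @ [b]))
        (insert c K) (if b then insert c P else P) \<and>
      (\<exists>V. knows V (insert c K) (if b then insert c P else P))"
    using c by blast
qed (rule steady_prefix)

lemma explores_forward_again:
  assumes S: "search [] N (heads l1) m K P" and l1: "l1 \<in> steady n \<tau> w" "length l1 = N"
  shows "explores (clauses n) N K P (\<lambda>l K P. (\<exists>V. knows V K P) \<and>
    (l \<in> steady n \<tau> w \<longrightarrow> (\<exists>B. length B = h \<and> search B (N + length l) (heads l1 + heads l) (heads l) K P)))"
proof -
  \<comment> \<open>The remaining surplus is at least \<tau>w/8; the \<open>+ 1\<close> covers the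
    rounding up in \<open>h\<close>.\<close>
  have room: "h < real (heads l1 + heads l) - (N + length l) * r + 1" if "l \<in> steady n \<tau> w" for l
  proof -
    have "N * r + \<tau> * w / 4 - \<tau> * w / 16 \<le> heads l1"
      using steady_surplus [OF l1(1)] N_surplus l1(2) by simp
    moreover have "length l * r - \<tau> * w / 16 \<le> heads l"
    proof -
      have "0 \<le> \<tau> * length l / (8 * n)" using \<tau> by simp
      then show ?thesis using steady_surplus [OF that] by linarith
    qed
    ultimately show ?thesis using h_bounds(2) by (simp add: algebra_simps)
  qed
  show ?thesis
  proof (rule explores_while)
    have "N * r \<le> 3 * w" by (rule queries_le) simp
    then show "\<exists>V. knows V K P"
      using search_knows [OF S] steady_heads_le [OF l1(1)] by simp
    show "\<exists>B. length B = h \<and> search B (N + length []) (heads l1 + heads []) (heads []) K P"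
      if "[] \<in> steady n \<tau> w"
      using search_split [OF S h_bounds(3)] room [OF that] by simp
  next
    fix l K P assume l: "length l < N" "l \<in> steady n \<tau> w"
      and "\<exists>B. length B = h \<and> search B (N + length l) (heads l1 + heads l) (heads l) K P"
    then obtain B where B: "length B = h" and S: "search B (N + length l) (heads l1 + heads l) (heads l) K P"
      by blast
    have pos: "heads l1 + heads l \<le> 16 * w" using steady_heads_le [OF l(2)] steady_heads_le [OF l1(1)] by simp
    have k: "real (N + length l) * r \<le> 3 * w" "real (N + length l + 1) * r \<le> 3 * w"
      using l by (intro queries_le; simp)+
    obtain c where c: "c \<in> clauses n - K" and S': "\<And>b. search B (N + length l + 1)
        (heads l1 + heads l + of_bool b) (heads l + of_bool b) (insert c K) (if b then insert c P else P)"
      using search_step [OF S k(1) pos] room [OF l(2)] B by auto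
    have "\<exists>V. knows V (insert c K) (if b then insert c P else P)" for b
      by (rule search_knows [OF S' k(2)]) (use pos in \<open>cases b; simp\<close>)
    moreover have "search B (N + length (l @ [b])) (heads l1 + heads (l @ [b])) (heads (l @ [b]))
        (insert c K) (if b then insert c P else P)" for b
      using S' [of b] by (cases b) simp_all
    ultimately show "\<exists>c\<in>clauses n - K. \<forall>b. (\<exists>B. length B = h \<and> search B (N + length (l @ [b]))
          (heads l1 + heads (l @ [b])) (heads (l @ [b])) (insert c K) (if b then insert c P else P)) \<and>
        (\<exists>V. knows V (insert c K) (if b then insert c P else P))"
      using c B by blast
  qed (rule steady_prefix)
qed

lemma explores_backward:
  assumes spine: "spine V1 K1 P1 B D" and B: "length B = h" and D: "w \<le> card D"
  shows "explores (clauses n) N K1 P1 (\<lambda>l K P. \<exists>V. knows V K P \<and>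
    (l \<in> steady n \<tau> w \<longrightarrow> hourglass_found V P))"
proof -
  let ?S = "\<lambda>l K P. \<exists>R. inflow V1 K1 P1 B (length l) (heads l) K P R"
  have "explores (clauses n) N K1 P1 (\<lambda>l K P. (\<exists>V. knows V K P) \<and> (l \<in> steady n \<tau> w \<longrightarrow> ?S l K P))"
  proof (rule explores_while)
    have "inflow V1 K1 P1 B 0 0 K1 P1 (set B)" using spine by (rule inflow_init)
    then show "\<exists>V. knows V K1 P1" "?S [] K1 P1" using inflow_knows [OF spine] by fastforce+
  next
    fix l K P assume l: "length l < N" "l \<in> steady n \<tau> w" and "?S l K P"
    then obtain R where R: "inflow V1 K1 P1 B (length l) (heads l) K P R" by blast
    have pos: "heads l \<le> 8 * w" using steady_heads_le [OF l(2)] .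
    have "0 \<le> \<tau> * length l / (8 * n)" "0 < \<tau> * w" using \<tau> w by auto
    \<comment> \<open>The walk is at most \<tau>w/16 behind, less than the head start
      \<open>h\<close>.\<close>
    then have "length l * r < length B + real (heads l)"
      using steady_surplus [OF l(2)] h_bounds(1) B by linarith
    then obtain c where c: "c \<in> clauses n - K" and "\<And>b. \<exists>R'. inflow V1 K1 P1 B (length l + 1)
        (heads l + of_bool b) (insert c K) (if b then insert c P else P) R'"
      using inflow_step [OF spine R pos] by auto
    then obtain R' where R': "\<And>b. inflow V1 K1 P1 B (length l + 1)
        (heads l + of_bool b) (insert c K) (if b then insert c P else P) (R' b)"
      by metis
    have "\<exists>V. knows V (insert c K) (if b then insert c P else P)" for b
      using inflow_knows [OF spine R' [of b]] pos by (cases b) auto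
    moreover have "?S (l @ [b]) (insert c K) (if b then insert c P else P)" for b
      using R' [of b] by (cases b) auto
    ultimately show "\<exists>c\<in>clauses n - K. \<forall>b. ?S (l @ [b]) (insert c K) (if b then insert c P else P) \<and>
        (\<exists>V. knows V (insert c K) (if b then insert c P else P))"
      using c by blast
  qed (rule steady_prefix)
  then show ?thesis
  proof (rule explores_mono)
    fix l K P assume l: "length l = N" and *: "(\<exists>V. knows V K P) \<and> (l \<in> steady n \<tau> w \<longrightarrow> ?S l K P)"
    show "\<exists>V. knows V K P \<and> (l \<in> steady n \<tau> w \<longrightarrow> hourglass_found V P)"
    proof (cases "l \<in> steady n \<tau> w")
      case True
      with * obtain R where R: "inflow V1 K1 P1 B (length l) (heads l) K P R" by blast
      have pos: "heads l \<le> 8 * w" using steady_heads_le [OF True] .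
      have "N * r = w * (1 + \<tau> / 4)" using n by (simp add: N_def r_def field_simps)
      moreover have "N * r + \<tau> * w / 4 - \<tau> * w / 16 \<le> heads l"
        using steady_surplus [OF True] N_surplus l by simp
      moreover have "0 < \<tau> * w" using \<tau> w by simp
      ultimately have "real w < heads l" by (simp add: algebra_simps)
      then have "w < card R" using R by (simp add: inflow_def)
      then show ?thesis
        using inflow_hourglass [OF spine R pos _ D] inflow_knows [OF spine R] pos by fastforce
    qed (use * in blast)
  qed
qed

lemma explores_nothing:
  assumes "knows V K P"
  shows "explores (clauses n) M K P (\<lambda>l K P. \<exists>V. knows V K P)"
  by (rule explores_invariant) (use assms in auto)

text \<open>After a piece that is not steady the rest of the block is idled away: every block
  consumes exactly \<open>6 * n * w\<close> coins and hands on \<open>knows\<close>, even if it is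
  bad.\<close>

theorem explores_block:
  "explores (clauses n) (6 * n * w) K0 P0 (\<lambda>l K P. \<exists>V. knows V K P \<and>
    (l \<in> good n \<tau> w \<longrightarrow> hourglass_found V P))"
proof -
  \<comment> \<open>The thirds are treated from the last to the first, since a continuation must be
    ready for every outcome of the preceding piece.\<close>
  have 1: "explores (clauses n) N K P (\<lambda>l. \<lambda>K P. \<exists>V. knows V K P \<and>
      (l1 @ l2 @ l \<in> good n \<tau> w \<longrightarrow> hourglass_found V P))"
    if l1: "length l1 = N" "l1 \<in> steady n \<tau> w" and l2: "length l2 = N"
      and kn: "\<exists>V. knows V K P"
      and S: "l2 \<in> steady n \<tau> w \<Longrightarrow> \<exists>B. length B = h \<and> search B (N + N) (heads l1 + heads l2) (heads l2) K P"
    for l1 l2 K P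
  proof (cases "l2 \<in> steady n \<tau> w")
    case True
    then obtain B where B: "length B = h" "search B (N + N) (heads l1 + heads l2) (heads l2) K P"
      using S by blast
    have "real (N + N) * r \<le> 3 * w" by (rule queries_le) simp
    moreover have "heads l1 + heads l2 \<le> 16 * w"
      using steady_heads_le [OF True] steady_heads_le [OF l1(2)] by simp
    moreover have "B \<noteq> []" using B(1) h_bounds(3) by auto
    ultimately obtain V1 D where V1: "spine V1 K P B D" "heads l2 \<le> card D"
      using search_spine [OF B(2)] by blast
    have "N * r = w * (1 + \<tau> / 4)" using n by (simp add: N_def r_def field_simps)
    moreover have "N * r + \<tau> * w / 4 - \<tau> * w / 16 \<le> heads l2"
      using steady_surplus [OF True] N_surplus l2 by simp
    moreover have "0 < \<tau> * w" using \<tau> w by simp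
    ultimately have "real w \<le> heads l2" by (simp add: algebra_simps)
    then have "w \<le> card D" using V1(2) by simp
    from explores_backward [OF V1(1) B(1) this] show ?thesis
    proof (rule explores_mono)
      fix l K P assume "\<exists>V. knows V K P \<and> (l \<in> steady n \<tau> w \<longrightarrow> hourglass_found V P)"
      then show "\<exists>V. knows V K P \<and> (l1 @ l2 @ l \<in> good n \<tau> w \<longrightarrow> hourglass_found V P)"
        using l1 l2 by (auto simp: good_def N_def)
    qed
  next
    case False
    then have "l1 @ l2 @ l \<notin> good n \<tau> w" for l using l1 l2 by (auto simp: good_def N_def)
    then show ?thesis using explores_nothing kn by fastforce
  qed
  have 2: "explores (clauses n) (N + N) K P (\<lambda>l. \<lambda>K P. \<exists>V. knows V K P \<and>
      (l1 @ l \<in> good n \<tau> w \<longrightarrow> hourglass_found V P))"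
    if l1: "length l1 = N" and kn: "\<exists>V. knows V K P"
      and S: "l1 \<in> steady n \<tau> w \<Longrightarrow> search [] N (heads l1) (heads l1) K P"
    for l1 K P
  proof (cases "l1 \<in> steady n \<tau> w")
    case True
    from explores_forward_again [OF S [OF True] True l1] show ?thesis
      by (rule explores_append) (use 1 [OF l1 True] in auto)
  next
    case False
    then have "l1 @ l \<notin> good n \<tau> w" for l using l1 by (auto simp: good_def N_def)
    then show ?thesis using explores_nothing kn by fastforce
  qed
  have "explores (clauses n) (N + (N + N)) K0 P0 (\<lambda>l K P. \<exists>V. knows V K P \<and>
      (l \<in> good n \<tau> w \<longrightarrow> hourglass_found V P))"
    by (rule explores_append [OF explores_forward]) (use 2 in auto)
  moreover have "N + (N + N) = 6 * n * w" by (simp add: N_def)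
  ultimately show ?thesis by simp
qed

end

subsection \<open>Many blocks\<close>

text \<open>Recording disjointness for variables instead of literals yields disjointness and mutual
  strict distinctness at once.\<close>

definition family :: "nat \<Rightarrow> nat \<Rightarrow> formula \<Rightarrow> nat set \<Rightarrow> hourglass set \<Rightarrow> bool" where
  "family n w P V H \<longleftrightarrow> finite H \<and>
    (\<forall>h\<in>H. is_hourglass (implication_digraph n P) h \<and> lit_var ` hourglass_verts h \<subseteq> V \<and>
      card (in_portion h) \<in> {w..32 * w} \<and> card (out_portion h) \<in> {w..32 * w}) \<and>
    pairwise (\<lambda>h h'. lit_var ` hourglass_verts h \<inter> lit_var ` hourglass_verts h' = {}) H"

lemma family_mono:
  assumes "family n w P V H" "P \<subseteq> P'" "V \<subseteq> V'"
  shows "family n w P' V' H"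
  using assms is_hourglass_mono unfolding family_def by blast

text \<open>Each block instantiates the locale with the variables touched by its predecessors as
  \<open>V0\<close>. Its hourglass avoids \<open>V0\<close> and can join the family; the block uses
  up \<open>32 * w\<close> of the room.\<close>

lemma explores_blocks:
  assumes n: "0 < n" and w: "1 \<le> w" and \<tau>: "0 < \<tau>" "\<tau> \<le> 1"
    and "real (card V + 32 * w * J) \<le> \<tau> * n / 5"
    and "V \<subseteq> {1..n}" "K \<subseteq> clauses n" "\<forall>c\<in>K. \<exists>z\<in>c. lit_var z \<in> V" "P \<subseteq> K" "family n w P V H"
  shows "explores (clauses n) (J * (6 * n * w)) K P (\<lambda>l K P. \<exists>V H'.
    family n w P V H' \<and> card H' = card H + good_blocks (6 * n * w) (good n \<tau> w) J l)"
  using assms(5-)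
proof (induction J arbitrary: V K P H)
  case 0
  then show ?case by auto
next
  case (Suc J)
  let ?L = "6 * n * w" and ?G = "good n \<tau> w"
  interpret exploration n w \<tau> V K P
  proof
    have "real (card V + 32 * w) \<le> real (card V + 32 * w * Suc J)" by simp
    then show "real (card V + 32 * w) \<le> \<tau> * n / 5" using Suc.prems(1) by linarith
  qed (use n w \<tau> Suc.prems in auto)
  have "explores (clauses n) (?L + J * ?L) K P (\<lambda>l K P. \<exists>V H'.
    family n w P V H' \<and> card H' = card H + good_blocks ?L ?G (Suc J) l)"
  proof (rule explores_append [OF explores_block])
    fix l K' P' assume l: "length l = ?L"
      and "\<exists>V'. knows V' K' P' \<and> (l \<in> ?G \<longrightarrow> hourglass_found V' P')"
    then obtain V' where V': "knows V' K' P'" "l \<in> ?G \<longrightarrow> hourglass_found V' P'" by blast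
    have kn: "V \<subseteq> V'" "V' \<subseteq> {1..n}" "K' \<subseteq> clauses n" "\<forall>c\<in>K'. \<exists>z\<in>c. lit_var z \<in> V'" "P \<subseteq> P'" "P' \<subseteq> K'"
      and cardV': "card V' \<le> card V + 32 * w"
      using V'(1) by (auto simp: knows_def)
    have fam: "family n w P' V' H" by (rule family_mono [OF Suc.prems(6) kn(5,1)])
    obtain H' where H': "family n w P' V' H'" "card H' = card H + of_bool (l \<in> ?G)"
    proof (cases "l \<in> ?G")
      case True
      then obtain h where h: "is_hourglass (implication_digraph n P') h"
        "lit_var ` hourglass_verts h \<subseteq> V' - V"
        "card (in_portion h) \<in> {w..32 * w}" "card (out_portion h) \<in> {w..32 * w}"
        using V'(2) by (auto simp: hourglass_found_def)
      have sub: "lit_var ` hourglass_verts h' \<subseteq> V" if "h' \<in> H" for h'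
        using Suc.prems(6) that by (auto simp: family_def)
      have ne: "hourglass_verts h \<noteq> {}" by (cases h) auto
      have "h \<notin> H" using sub [of h] h(2) ne by auto
      then have "card (insert h H) = card H + 1" using fam by (simp add: family_def)
      moreover have "family n w P' V' (insert h H)"
      proof -
        have "lit_var ` hourglass_verts h \<inter> lit_var ` hourglass_verts h' = {}"
          "lit_var ` hourglass_verts h' \<inter> lit_var ` hourglass_verts h = {}" if "h' \<in> H" for h'
          using sub [OF that] h(2) by blast+
        moreover have "lit_var ` hourglass_verts h \<subseteq> V'" using h(2) by blast
        ultimately show ?thesis
          using fam h(1,3,4) unfolding family_def pairwise_insert by blast
      qed
      ultimately show ?thesis using that True by auto
    next
      case False
      then show ?thesis using that fam by simp
    qed
    have "real (card V' + 32 * w * J) \<le> real (card V + 32 * w * Suc J)" using cardV' by simp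
    then have "real (card V' + 32 * w * J) \<le> \<tau> * n / 5" using Suc.prems(1) by linarith
    from Suc.IH [OF this kn(2-4,6) H'(1)]
    show "explores (clauses n) (J * ?L) K' P' (\<lambda>l'. \<lambda>K P. \<exists>V H'.
        family n w P V H' \<and> card H' = card H + good_blocks ?L ?G (Suc J) (l @ l'))"
      using l H'(2) by (simp add: add.assoc)
  qed
  then show ?case by simp
qed

lemma prob_family_ge:
  fixes x :: real
  assumes "0 < n" "1 \<le> w" "0 < \<tau>" "\<tau> \<le> 1" "real (32 * w * J) \<le> \<tau> * n / 5" and p: "0 \<le> p" "p \<le> 1"
  shows "measure_pmf.prob (coins (J * (6 * n * w)) p) {l. x < real (good_blocks (6 * n * w) (good n \<tau> w) J l)} \<le>
    measure_pmf.prob (random_formula n p) {F. \<exists>V H. family n w F V H \<and> x < card H}"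
proof -
  let ?R = "\<lambda>(l::bool list) (K::formula) P. \<exists>V H'. family n w P V H' \<and> card H' = good_blocks (6 * n * w) (good n \<tau> w) J l"
  have fam: "family n w {} {} {}" by (simp add: family_def)
  have ex: "explores (clauses n) (J * (6 * n * w)) {} {} ?R"
    using explores_blocks [of n w \<tau> "{}" J "{}" "{}" "{}"] assms fam by simp
  have "measure_pmf.prob (coins (J * (6 * n * w)) p) {l. x < real (good_blocks (6 * n * w) (good n \<tau> w) J l)} \<le>
      measure_pmf.prob (coins (J * (6 * n * w)) p) {l. \<forall>K' P'. ?R l K' P' \<longrightarrow>
        (\<forall>F. P' \<subseteq> F \<longrightarrow> (\<exists>V H. family n w F V H \<and> x < card H))}"
  proof (rule measure_pmf.finite_measure_mono)
    show "{l. x < real (good_blocks (6 * n * w) (good n \<tau> w) J l)} \<subseteq> {l. \<forall>K' P'. ?R l K' P' \<longrightarrow>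
        (\<forall>F. P' \<subseteq> F \<longrightarrow> (\<exists>V H. family n w F V H \<and> x < card H))}"
    proof clarsimp
      fix l :: "bool list" and P F :: formula and V H
      assume "x < real (good_blocks (6 * n * w) (good n \<tau> w) J l)" "family n w P V H"
        "card H = good_blocks (6 * n * w) (good n \<tau> w) J l" "P \<subseteq> F"
      then show "\<exists>V H. family n w F V H \<and> x < real (card H)"
        using family_mono [of n w P V H F V] by (intro exI [of _ V] exI [of _ H]) simp
    qed
  qed simp
  also have "\<dots> \<le> measure_pmf.prob (map_pmf (\<lambda>X. {} \<union> X) (random_subset (clauses n - {}) p))
      {F. \<exists>V H. family n w F V H \<and> x < card H}"
    by (rule explores_prob [OF finite_clauses p ex])
  also have "map_pmf (\<lambda>X. {} \<union> X) (random_subset (clauses n - {}) p) = random_formula n p"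
    by (simp add: random_subset_def random_formula_def)
  finally show ?thesis .
qed

subsection \<open>Probability of a good block\<close>

text \<open>(1 - x + x^2/2)(1 + x + x^2/2) = 1 + x^4/4, combined with the quadratic lower bound for
  exp x.\<close>

lemma exp_neg_le_quadratic:
  fixes x :: real
  assumes "0 \<le> x"
  shows "exp (- x) \<le> 1 - x + x\<^sup>2 / 2"
proof -
  have pos: "0 < 1 + x + x\<^sup>2 / 2" using assms by (simp add: add_pos_nonneg)
  have "1 \<le> (1 - x + x\<^sup>2 / 2) * (1 + x + x\<^sup>2 / 2)"
    using zero_le_power [of "x\<^sup>2" 2] by (simp add: algebra_simps power2_eq_square)
  then have "1 / (1 + x + x\<^sup>2 / 2) \<le> 1 - x + x\<^sup>2 / 2"
    using pos by (simp add: divide_le_eq)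
  moreover have "exp (- x) \<le> 1 / (1 + x + x\<^sup>2 / 2)"
    using exp_lower_Taylor_quadratic [OF assms] pos by (simp add: exp_minus inverse_eq_divide frac_le)
  ultimately show ?thesis by simp
qed

lemma prob_not_steady:
  assumes n: "0 < n" and \<tau>: "0 < \<tau>" "\<tau> \<le> 1"
  shows "measure_pmf.prob (coins (2 * n * w) ((1 + \<tau>) / (2 * real n))) (- steady n \<tau> w) \<le> 2 * exp (- (\<tau>\<^sup>2 * w / 32))"
proof -
  define p where "p = (1 + \<tau>) / (2 * real n)"
  \<comment> \<open>With this choice the exponent bounding the moment generating function is
    -\<tau>^2(1 - \<tau>)/(16n), and \<theta> times the tolerance \<tau>w/16 is \<tau>^2
    w/32.\<close>
  define \<theta> where "\<theta> = \<tau> / 2"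
  define \<rho> where "\<rho> = (1 + \<tau> / 2) / (2 * real n)"
  let ?M = "coins (2 * n * w) p"
  have p: "0 \<le> p" "p \<le> 1" using n \<tau> by (auto simp: p_def field_simps)
  have \<theta>: "0 \<le> \<theta>" using \<tau> by (simp add: \<theta>_def)
  have "p * exp (\<theta> * (\<rho> - 1)) + (1 - p) * exp (\<theta> * \<rho>) = exp (\<theta> * \<rho>) * (1 + p * (exp (- \<theta>) - 1))"
    by (simp add: algebra_simps exp_diff exp_minus divide_inverse)
  also have "\<dots> \<le> exp (\<theta> * \<rho>) * exp (p * (exp (- \<theta>) - 1))"
    by (intro mult_left_mono) auto
  also have "\<dots> \<le> exp (\<theta> * \<rho>) * exp (p * (- \<theta> + \<theta>\<^sup>2 / 2))"
    using exp_neg_le_quadratic [OF \<theta>] p by (intro mult_left_mono exp_mono) auto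
  also have "\<dots> = exp (- (\<tau>\<^sup>2 * (1 - \<tau>) / (16 * n)))"
    using n by (simp add: p_def \<theta>_def \<rho>_def field_simps power2_eq_square flip: exp_add)
  also have "\<dots> \<le> 1" using \<tau> by simp
  finally have mgf: "p * exp (\<theta> * (\<rho> - 1)) + (1 - p) * exp (\<theta> * \<rho>) \<le> 1" .
  have 1: "measure_pmf.prob ?M {l. \<exists>q\<le>length l. heads (take q l) < \<rho> * q - \<tau> * w / 16} \<le> exp (- (\<tau>\<^sup>2 * w / 32))"
    using coins_maximal_inequality [OF p \<theta> mgf, of "2 * n * w" "\<tau> * w / 16"]
    by (simp add: \<theta>_def power2_eq_square mult.assoc)
  \<comment> \<open>The mean number of heads is at most 2w and 2^(-8w) is at most exp(-4w), so the
    cap costs at most exp(-2w).\<close>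
  have "measure_pmf.prob ?M {l. real (8 * w) \<le> heads l} \<le> (1 + p) ^ (2 * n * w) * 2 powr (- real (8 * w))"
    by (rule heads_tail_bound [OF p])
  also have "\<dots> \<le> exp p ^ (2 * n * w) * exp (- (4 * real w))"
  proof (intro mult_mono power_mono)
    have "exp (1 / 2) \<le> (2::real)" using exp_bound [of "1 / 2"] by (simp add: power2_eq_square)
    then have "1 / 2 \<le> ln (2::real)" by (subst ln_ge_iff) simp_all
    then have "8 * w * (1 / 2) \<le> 8 * w * ln (2::real)" by (intro mult_left_mono) auto
    then show "2 powr (- real (8 * w)) \<le> exp (- (4 * real w))" by (simp add: powr_def)
  qed (use p in auto)
  also have "\<dots> = exp (2 * n * w * p - 4 * w)"
    by (simp add: exp_diff exp_minus divide_inverse flip: exp_of_nat_mult)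
  also have "\<dots> \<le> exp (- (\<tau>\<^sup>2 * w / 32))"
  proof -
    have "2 * n * w * p = (1 + \<tau>) * w" using n by (simp add: p_def)
    also have "\<dots> \<le> 2 * real w" using \<tau> by (intro mult_right_mono) auto
    finally have "2 * n * w * p \<le> 2 * real w" .
    moreover have "\<tau>\<^sup>2 * w \<le> 1 * real w" using \<tau> by (intro mult_right_mono power_le_one) auto
    ultimately show ?thesis by simp
  qed
  finally have 2: "measure_pmf.prob ?M {l. real (8 * w) \<le> heads l} \<le> exp (- (\<tau>\<^sup>2 * w / 32))" .
  have "measure_pmf.prob ?M (- steady n \<tau> w) \<le>
      measure_pmf.prob ?M ({l. \<exists>q\<le>length l. heads (take q l) < \<rho> * q - \<tau> * w / 16} \<union> {l. real (8 * w) \<le> heads l})"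
    by (rule measure_pmf.finite_measure_mono) (auto simp: steady_def \<rho>_def not_le)
  also have "\<dots> \<le> exp (- (\<tau>\<^sup>2 * w / 32)) + exp (- (\<tau>\<^sup>2 * w / 32))"
    by (rule order_trans [OF measure_Un_le add_mono [OF 1 2]]) simp_all
  finally show ?thesis by (simp add: p_def)
qed

lemma prob_good_ge:
  assumes n: "0 < n" and \<tau>: "0 < \<tau>" "\<tau> \<le> 1"
  shows "1 - 6 * exp (- (\<tau>\<^sup>2 * w / 32)) \<le>
    measure_pmf.prob (coins (6 * n * w) ((1 + \<tau>) / (2 * real n))) (good n \<tau> w)"
proof -
  define p where "p = (1 + \<tau>) / (2 * real n)"
  define s where "s = measure_pmf.prob (coins (2 * n * w) p) (steady n \<tau> w)"
  have p: "0 \<le> p" "p \<le> 1" using n \<tau> by (auto simp: p_def field_simps)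
  have s: "s \<le> 1" "0 \<le> s" "1 - 2 * exp (- (\<tau>\<^sup>2 * w / 32)) \<le> s"
    using prob_not_steady [OF assms, of w] measure_pmf.prob_compl [of "steady n \<tau> w" "coins (2 * n * w) p"]
    by (auto simp: s_def p_def Compl_eq_Diff_UNIV)
  have "6 * n * w = 2 * n * w + (2 * n * w + 2 * n * w)" by simp
  then have "measure_pmf.prob (coins (6 * n * w) p) (good n \<tau> w) = s * (s * s)"
    unfolding good_def s_def by (simp only: prob_coins_add [OF p])
  \<comment> \<open>Bernoulli's inequality for s^3 at s = 1 - (1 - s).\<close>
  moreover have "3 * s - 2 \<le> s * (s * s)"
  proof -
    have "0 \<le> (s - 1)\<^sup>2 * (s + 2)" using s by simp
    then show ?thesis by (simp add: power2_eq_square algebra_simps)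
  qed
  ultimately show ?thesis using s(3) by (simp add: p_def)
qed

text \<open>For the supercritical coins the failure probability is at most 6 exp(-192/32), below
  1/2. The likelihood ratio of one coin has second moment at most 1 + 8 \<epsilon>^2/n, hence at
  most exp(48 \<epsilon>^2 w) over 6nw coins, and 48 * 193 = 9264. The factor 1/4 is the square of
  1/2.\<close>

lemma prob_subcritical_good_ge:
  assumes n: "0 < n" and \<epsilon>: "0 < \<epsilon>" "\<epsilon> \<le> 1 / 2" and w: "192 \<le> \<epsilon>\<^sup>2 * w" "\<epsilon>\<^sup>2 * w \<le> 193"
  shows "exp (- 9264) / 4 \<le> measure_pmf.prob (coins (6 * n * w) ((1 - \<epsilon>) / (2 * real n))) (good n \<epsilon> w)"
proof -
  define p p' where "p = (1 - \<epsilon>) / (2 * real n)" and "p' = (1 + \<epsilon>) / (2 * real n)"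
  define \<xi> where "\<xi> = p'\<^sup>2 / p + (1 - p')\<^sup>2 / (1 - p)"
  define g where "g = measure_pmf.prob (coins (6 * n * w) p) (good n \<epsilon> w)"
  have p: "1 / (4 * n) \<le> p" "p \<le> 1 / 2"
    using n \<epsilon> by (auto simp: p_def field_simps)
  have p0: "0 < p" "p < 1" using p n by (auto intro: less_le_trans [rotated])
  have p': "0 \<le> p'" "p' \<le> 1" using n \<epsilon> by (auto simp: p'_def field_simps)
  have "1 / (4 * n) * (1 / 2) \<le> p * (1 - p)"
    using p p0 n by (intro mult_mono) auto
  then have pp: "1 / (8 * n) \<le> p * (1 - p)" by simp
  have "\<xi> = 1 + (p' - p)\<^sup>2 / (p * (1 - p))"
    using p0 by (simp add: \<xi>_def field_simps power2_eq_square)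
  also have "(p' - p)\<^sup>2 = \<epsilon>\<^sup>2 / n ^ 2"
    using n by (simp add: p_def p'_def field_simps power2_eq_square)
  also have "1 + \<epsilon>\<^sup>2 / n ^ 2 / (p * (1 - p)) \<le> 1 + \<epsilon>\<^sup>2 / n ^ 2 / (1 / (8 * n))"
    using pp n p0 by (intro add_left_mono divide_left_mono mult_pos_pos) auto
  also have "\<dots> = 1 + 8 * \<epsilon>\<^sup>2 / n" using n by (simp add: power2_eq_square)
  also have "\<dots> \<le> exp (8 * \<epsilon>\<^sup>2 / n)" by (rule exp_ge_add_one_self)
  finally have "\<xi> ^ (6 * n * w) \<le> exp (8 * \<epsilon>\<^sup>2 / n) ^ (6 * n * w)"
    using p0 by (intro power_mono) (auto simp: \<xi>_def)
  also have "\<dots> = exp (48 * (\<epsilon>\<^sup>2 * w))" using n by (simp flip: exp_of_nat_mult)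
  also have "\<dots> \<le> exp 9264" using w by (simp add: mult.commute)
  finally have \<xi>: "\<xi> ^ (6 * n * w) \<le> exp 9264" .
  have "1 + 6 + 6\<^sup>2 / 2 \<le> exp (6::real)" by (rule exp_lower_Taylor_quadratic) simp
  then have "6 * exp (- 6) \<le> (1 / 2 :: real)" by (simp add: exp_minus field_simps)
  moreover have "exp (- (\<epsilon>\<^sup>2 * w / 32)) \<le> exp (- 6)" using w by simp
  ultimately have "1 - 1 / 2 \<le> 1 - 6 * exp (- (\<epsilon>\<^sup>2 * w / 32))" by linarith
  also have "\<dots> \<le> measure_pmf.prob (coins (6 * n * w) p') (good n \<epsilon> w)"
    unfolding p'_def using \<epsilon> by (intro prob_good_ge n) auto
  finally have "(1 / 2)\<^sup>2 \<le> (measure_pmf.prob (coins (6 * n * w) p') (good n \<epsilon> w))\<^sup>2"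
    by (intro power_mono) auto
  also have "\<dots> \<le> g * \<xi> ^ (6 * n * w)"
    unfolding g_def \<xi>_def by (rule coins_change_of_measure [OF p0 p'])
  also have "\<dots> \<le> g * exp 9264" by (intro mult_left_mono \<xi>) (simp add: g_def)
  finally show ?thesis by (simp add: g_def p_def exp_minus field_simps power2_eq_square)
qed

text \<open>The power of 1 - q/2 gives exp(-qJ/2), and the threshold qJ/4 costs at most
  exp(qJ/4).\<close>

lemma prob_many_good_blocks:
  assumes p: "0 \<le> p" "p \<le> 1" and q: "0 \<le> q" "q \<le> measure_pmf.prob (coins L p) G"
  shows "1 - exp (- (q * J / 4)) \<le> measure_pmf.prob (coins (J * L) p) {l. q * J / 4 < real (good_blocks L G J l)}"
proof -
  let ?M = "coins (J * L) p" and ?x = "q * J / 4"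
  have q1: "q \<le> 1" using q(2) measure_pmf.prob_le_1 by (rule order_trans)
  have "measure_pmf.prob ?M {l. real (good_blocks L G J l) \<le> ?x} \<le> (1 - q / 2) ^ J * 2 powr ?x"
    by (rule prob_few_good_blocks [OF p q])
  also have "\<dots> \<le> exp (- (q / 2)) ^ J * exp ?x"
  proof (intro mult_mono power_mono)
    have "1 + - (q / 2) \<le> exp (- (q / 2))" by (rule exp_ge_add_one_self)
    then show "1 - q / 2 \<le> exp (- (q / 2))" by simp
    have "?x * ln 2 \<le> ?x * 1" using q(1) ln_2_less_1 by (intro mult_left_mono) auto
    then show "2 powr ?x \<le> exp ?x" by (simp add: powr_def)
  qed (use q1 in auto)
  also have "\<dots> = exp (- ?x)"
    by (simp add: field_simps flip: exp_of_nat_mult exp_add)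
  finally have "measure_pmf.prob ?M {l. real (good_blocks L G J l) \<le> ?x} \<le> exp (- ?x)" .
  moreover have "{l. ?x < real (good_blocks L G J l)} = UNIV - {l. real (good_blocks L G J l) \<le> ?x}" by auto
  ultimately show ?thesis
    using measure_pmf.prob_compl [of "{l. real (good_blocks L G J l) \<le> ?x}" ?M] by simp
qed

section \<open>The subcritical and the supercritical regime\<close>

lemma family_distinct:
  assumes "family n w P V H"
  shows "disjoint_hourglasses H" "mutually_strictly_distinct H"
proof -
  have *: "lit_var u \<noteq> lit_var z" if "h \<in> H" "h' \<in> H" "h \<noteq> h'" "u \<in> hourglass_verts h" "z \<in> hourglass_verts h'" for h h' u z
    using assms that unfolding family_def pairwise_def by blast
  then show "disjoint_hourglasses H" unfolding disjoint_hourglasses_def pairwise_def by blast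
  show "mutually_strictly_distinct H"
    unfolding mutually_strictly_distinct_def pairwise_def strictly_distinct_iff using * by blast
qed

lemma prob_subcritical_family:
  fixes \<kappa> :: real
  assumes n: "0 < n" and \<epsilon>: "0 < \<epsilon>" "\<epsilon> \<le> 1 / 2" and large: "64000 \<le> \<epsilon> ^ 3 * n"
  defines "\<kappa> \<equiv> exp (- 9264 :: real) / 1024000"
  shows "1 - exp (- (\<kappa> * (\<epsilon> ^ 3 * n))) \<le> measure_pmf.prob (random_formula n ((1 - \<epsilon>) / (2 * real n)))
    {F. \<exists>w V H. 1 / \<epsilon>\<^sup>2 \<le> real w \<and> family n w F V H \<and> \<kappa> * (\<epsilon> ^ 3 * n) \<le> card H}"
proof -
  define w where "w = nat \<lceil>192 / \<epsilon>\<^sup>2\<rceil>"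
  \<comment> \<open>With \<epsilon>^2 w at most 193, the divisor 32000 gives 32wJ at most 193
    \<epsilon> n/1000, inside the room \<epsilon> n/5.\<close>
  define J where "J = nat \<lfloor>\<epsilon> ^ 3 * n / 32000\<rfloor>"
  define q :: real where "q = exp (- 9264) / 4"
  define p where "p = (1 - \<epsilon>) / (2 * real n)"
  have p: "0 \<le> p" "p \<le> 1" using n \<epsilon> by (auto simp: p_def field_simps)
  have q: "0 \<le> q" by (simp add: q_def)
  have \<epsilon>2: "0 < \<epsilon>\<^sup>2" "\<epsilon>\<^sup>2 \<le> 1" using \<epsilon> by (auto intro: power_le_one)
  have "0 < 192 / \<epsilon>\<^sup>2" using \<epsilon>2 by simp
  then have w: "192 / \<epsilon>\<^sup>2 \<le> w" "w < 192 / \<epsilon>\<^sup>2 + 1" "1 \<le> w" unfolding w_def by linarith+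
  have w': "192 \<le> \<epsilon>\<^sup>2 * w" using w(1) \<epsilon>2 by (simp add: field_simps)
  have "\<epsilon>\<^sup>2 * w \<le> \<epsilon>\<^sup>2 * (192 / \<epsilon>\<^sup>2 + 1)" using w(2) \<epsilon>2 by (intro mult_left_mono) auto
  also have "\<dots> = 192 + \<epsilon>\<^sup>2" using \<epsilon> by (simp add: distrib_left)
  finally have w'': "\<epsilon>\<^sup>2 * w \<le> 193" using \<epsilon>2 by linarith
  \<comment> \<open>\<open>large\<close> puts the rounded number at 2 or more, so rounding down
    loses at most a factor 2.\<close>
  have J: "J \<le> \<epsilon> ^ 3 * n / 32000" "\<epsilon> ^ 3 * n / 64000 \<le> J"
    using large unfolding J_def by linarith+
  have "real (32 * w * J) = 32 * w * real J" by simp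
  also have "\<dots> \<le> 32 * w * (\<epsilon> ^ 3 * n / 32000)" using J(1) by (intro mult_left_mono) auto
  also have "\<dots> = (\<epsilon>\<^sup>2 * w) * (\<epsilon> * n / 1000)" by (simp add: power2_eq_square power3_eq_cube)
  also have "\<dots> \<le> 193 * (\<epsilon> * n / 1000)" using w'' \<epsilon> by (intro mult_right_mono) auto
  also have "\<dots> \<le> \<epsilon> * n / 5" using \<epsilon> by simp
  finally have room: "real (32 * w * J) \<le> \<epsilon> * n / 5" .
  have \<kappa>: "\<kappa> * (\<epsilon> ^ 3 * n) \<le> q * J / 4"
  proof -
    have "\<kappa> * (\<epsilon> ^ 3 * n) = q / 4 * (\<epsilon> ^ 3 * n / 64000)" by (simp add: \<kappa>_def q_def)
    also have "\<dots> \<le> q / 4 * J" using J(2) q by (intro mult_left_mono) auto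
    finally show ?thesis by simp
  qed
  have "q \<le> measure_pmf.prob (coins (6 * n * w) p) (good n \<epsilon> w)"
    unfolding q_def p_def by (rule prob_subcritical_good_ge [OF n \<epsilon> w' w''])
  note many = prob_many_good_blocks [OF p q this, of J]
  have "1 - exp (- (\<kappa> * (\<epsilon> ^ 3 * n))) \<le> 1 - exp (- (q * J / 4))" using \<kappa> by simp
  also note many
  also have "measure_pmf.prob (coins (J * (6 * n * w)) p) {l. q * J / 4 < real (good_blocks (6 * n * w) (good n \<epsilon> w) J l)}
      \<le> measure_pmf.prob (random_formula n p) {F. \<exists>V H. family n w F V H \<and> q * J / 4 < card H}"
    using \<epsilon> by (intro prob_family_ge n w room p) auto
  also have "\<dots> \<le> measure_pmf.prob (random_formula n p)
      {F. \<exists>w V H. 1 / \<epsilon>\<^sup>2 \<le> real w \<and> family n w F V H \<and> \<kappa> * (\<epsilon> ^ 3 * n) \<le> card H}"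
  proof (rule measure_pmf.finite_measure_mono)
    have "1 / \<epsilon>\<^sup>2 \<le> w" using w(1) by (rule order_trans [rotated]) (simp add: divide_right_mono)
    then show "{F. \<exists>V H. family n w F V H \<and> q * J / 4 < card H} \<subseteq>
        {F. \<exists>w V H. 1 / \<epsilon>\<^sup>2 \<le> real w \<and> family n w F V H \<and> \<kappa> * (\<epsilon> ^ 3 * n) \<le> card H}"
      using \<kappa> by fastforce
  qed simp
  finally show ?thesis by (simp add: p_def)
qed

lemma prob_supercritical_hourglass:
  assumes n: "0 < n" and \<epsilon>: "0 < \<epsilon>" "\<epsilon> \<le> 1 / 2" and large: "64000 \<le> \<epsilon> ^ 3 * n"
  shows "1 - exp (- (\<epsilon> ^ 3 * n / 20480)) \<le> measure_pmf.prob (random_formula n ((1 + \<epsilon>) / (2 * real n)))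
    {F. \<exists>h. is_hourglass (implication_digraph n F) h \<and>
      card (in_portion h) \<in> {\<epsilon> * n / 320..\<epsilon> * n / 5} \<and> card (out_portion h) \<in> {\<epsilon> * n / 320..\<epsilon> * n / 5}}"
proof -
  \<comment> \<open>160 = 5 * 32: a single block may fill the whole room \<epsilon> n/5.\<close>
  define w where "w = nat \<lfloor>\<epsilon> * n / 160\<rfloor>"
  define p where "p = (1 + \<epsilon>) / (2 * real n)"
  define x where "x = \<epsilon> ^ 3 * n / 20480"
  have p: "0 \<le> p" "p \<le> 1" using n \<epsilon> by (auto simp: p_def field_simps)
  have "\<epsilon> ^ 3 * n \<le> \<epsilon> * n"
    using \<epsilon> power_decreasing [of 1 3 \<epsilon>] by (intro mult_right_mono) auto
  then have "320 \<le> \<epsilon> * n" using large by linarith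
  then have w: "w \<le> \<epsilon> * n / 160" "\<epsilon> * n / 320 \<le> w" "1 \<le> w" unfolding w_def by linarith+
  have room: "real (32 * w * 1) \<le> \<epsilon> * n / 5" using w(1) by simp
  have x: "3 \<le> x" using large by (simp add: x_def)
  \<comment> \<open>The available exponent is at least 2x; one half of it absorbs the factor 6, as
    exp x exceeds 6 for x at least 3.\<close>
  have "6 * exp (- (\<epsilon>\<^sup>2 * w / 32)) \<le> 6 * exp (- (2 * x))"
  proof -
    have "\<epsilon>\<^sup>2 * (\<epsilon> * n / 320) \<le> \<epsilon>\<^sup>2 * w" using w(2) by (intro mult_left_mono) auto
    then show ?thesis by (simp add: x_def power2_eq_square power3_eq_cube)
  qed
  also have "\<dots> = 6 * exp (- x) * exp (- x)" by (simp flip: exp_add)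
  also have "\<dots> \<le> 1 * exp (- x)"
  proof (intro mult_right_mono)
    have "1 + x + x\<^sup>2 / 2 \<le> exp x" using x by (intro exp_lower_Taylor_quadratic) auto
    moreover have "3\<^sup>2 \<le> x\<^sup>2" using x by (intro power_mono) auto
    ultimately have "6 \<le> exp x" using x by simp
    then show "6 * exp (- x) \<le> 1" by (simp add: exp_minus field_simps)
  qed simp
  finally have "1 - exp (- x) \<le> 1 - 6 * exp (- (\<epsilon>\<^sup>2 * w / 32))" by simp
  also have "\<dots> \<le> measure_pmf.prob (coins (6 * n * w) p) (good n \<epsilon> w)"
    unfolding p_def using \<epsilon> by (intro prob_good_ge n) auto
  also have "\<dots> = measure_pmf.prob (coins (6 * n * w + 0) p) {l. take (6 * n * w) l \<in> good n \<epsilon> w \<and> drop (6 * n * w) l \<in> UNIV}"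
    by (subst prob_coins_add [OF p]) simp
  also have "\<dots> = measure_pmf.prob (coins (1 * (6 * n * w)) p) {l. 1 / 2 < real (good_blocks (6 * n * w) (good n \<epsilon> w) 1 l)}"
    by (simp add: of_bool_def if_distrib cong: if_cong)
  also have "\<dots> \<le> measure_pmf.prob (random_formula n p) {F. \<exists>V H. family n w F V H \<and> 1 / 2 < card H}"
    using \<epsilon> by (intro prob_family_ge n w room p) auto
  also have "\<dots> \<le> measure_pmf.prob (random_formula n p) {F. \<exists>h. is_hourglass (implication_digraph n F) h \<and>
      card (in_portion h) \<in> {\<epsilon> * n / 320..\<epsilon> * n / 5} \<and> card (out_portion h) \<in> {\<epsilon> * n / 320..\<epsilon> * n / 5}}"
  proof (rule measure_pmf.finite_measure_mono, clarify)
    fix F V H assume fam: "family n w F V H" and "1 / 2 < real (card H)"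
    then have "H \<noteq> {}" by auto
    then obtain h where "h \<in> H" by blast
    then have "is_hourglass (implication_digraph n F) h" "card (in_portion h) \<in> {w..32 * w}"
      "card (out_portion h) \<in> {w..32 * w}"
      using fam by (auto simp: family_def)
    moreover have "real k \<in> {\<epsilon> * n / 320..\<epsilon> * n / 5}" if "k \<in> {w..32 * w}" for k
    proof -
      have "real w \<le> k" "real k \<le> 32 * w" using that by auto
      then show ?thesis using w(1,2) by auto
    qed
    ultimately show "\<exists>h. is_hourglass (implication_digraph n F) h \<and>
      card (in_portion h) \<in> {\<epsilon> * n / 320..\<epsilon> * n / 5} \<and> card (out_portion h) \<in> {\<epsilon> * n / 320..\<epsilon> * n / 5}"
      by blast
  qed simp
  finally show ?thesis by (simp add: p_def x_def)
qed

lemma cube_root_scaling: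
  fixes n :: nat and lam :: real
  assumes "0 < n"
  defines "\<epsilon> \<equiv> \<bar>lam\<bar> * real n powr (-1/3)"
  shows "\<epsilon> ^ 3 * n = \<bar>lam\<bar> ^ 3" and "\<epsilon> * n = \<bar>lam\<bar> * real n powr (2/3)"
    and "real n powr (2/3) / lam\<^sup>2 = 1 / \<epsilon>\<^sup>2"
proof -
  have n: "real n powr 1 = n" "0 < real n" using assms by simp_all
  have "(real n powr (-1/3)) ^ 3 = real n powr (-1)"
    using powr_powr [of "real n" "-1/3" 3] by (simp add: powr_numeral)
  then show "\<epsilon> ^ 3 * n = \<bar>lam\<bar> ^ 3"
    using n by (simp add: \<epsilon>_def power_mult_distrib powr_minus)
  have "real n powr (-1/3) * real n powr 1 = real n powr (2/3)"
    unfolding powr_add [symmetric] by simp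
  then show "\<epsilon> * n = \<bar>lam\<bar> * real n powr (2/3)"
    using n by (simp add: \<epsilon>_def)
  have "(real n powr (-1/3))\<^sup>2 = real n powr (-(2/3))"
    using powr_powr [of "real n" "-1/3" 2] by (simp add: powr_numeral)
  then have *: "\<epsilon>\<^sup>2 = lam\<^sup>2 / real n powr (2/3)"
    unfolding \<epsilon>_def power_mult_distrib by (simp only: power2_abs powr_minus divide_inverse)
  show "real n powr (2/3) / lam\<^sup>2 = 1 / \<epsilon>\<^sup>2"
    unfolding * by (simp only: divide_divide_eq_right mult_1)
qed

theorem theorem4p3:
  shows "\<exists>lam0 > (0::real). \<exists>eps0 > (0::real). eps0 < 1 \<and>
    (\<exists>c > (0::real). \<exists>k > (0::real). \<exists>a > (0::real). \<exists>b > (0::real).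
      \<forall>(n::nat) (lam::real).
        n > 0 \<longrightarrow> lam0 \<le> \<bar>lam\<bar> \<longrightarrow> \<bar>lam\<bar> \<le> eps0 * real n powr (1/3) \<longrightarrow>
        measure_pmf.prob
          (random_formula n (1 / (2 * real n) * (1 + lam * real n powr (-1/3))))
          {F. (lam < 0 \<longrightarrow>
                 (\<exists>H. finite H \<and> real (card H) \<ge> k * \<bar>lam\<bar> ^ 3 \<and>
                   disjoint_hourglasses H \<and> mutually_strictly_distinct H \<and>
                   (\<forall>h\<in>H. is_hourglass (implication_digraph n F) h \<and>
                     real (card (in_portion h)) \<ge> real n powr (2/3) / lam\<^sup>2 \<and>
                     real (card (out_portion h)) \<ge> real n powr (2/3) / lam\<^sup>2))) \<and>
              (lam > 0 \<longrightarrow>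
                 (\<exists>h. is_hourglass (implication_digraph n F) h \<and>
                   real (card (in_portion h)) \<in>
                     {a * (lam * real n powr (2/3)) .. b * (lam * real n powr (2/3))} \<and>
                   real (card (out_portion h)) \<in>
                     {a * (lam * real n powr (2/3)) .. b * (lam * real n powr (2/3))}))}
        \<ge> 1 - exp (- (c * \<bar>lam\<bar> ^ 3)))"
proof -
  define \<kappa> :: real where "\<kappa> = exp (- 9264) / 1024000"
  have \<kappa>: "0 < \<kappa>" by (simp add: \<kappa>_def)
  have "exp (- 9264) \<le> (1 :: real)" by simp
  then have \<kappa>': "\<kappa> \<le> 1 / 20480" unfolding \<kappa>_def by linarith
  \<comment> \<open>40^3 = 64000 supplies \<open>large\<close> in both regimes. The one constant
    \<open>\<kappa>\<close> serves as exponent rate and as density of hourglasses, being below the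
    supercritical rate 1/20480.\<close>
  show ?thesis
  proof (rule exI [of _ 40], rule conjI, simp, rule exI [of _ "1/2"], rule conjI, simp, rule conjI, simp,
      rule exI [of _ \<kappa>], rule conjI [OF \<kappa>], rule exI [of _ \<kappa>], rule conjI [OF \<kappa>],
      rule exI [of _ "1/320"], rule conjI, simp, rule exI [of _ "1/5"], rule conjI, simp, intro allI impI)
    fix n :: nat and lam :: real
    assume n: "n > 0" and lam: "40 \<le> \<bar>lam\<bar>" "\<bar>lam\<bar> \<le> 1 / 2 * real n powr (1/3)"
    define \<epsilon> where "\<epsilon> = \<bar>lam\<bar> * real n powr (-1/3)"
    note scale = cube_root_scaling [OF n, of lam, folded \<epsilon>_def]
    have \<epsilon>: "0 < \<epsilon>" using n lam(1) by (auto simp: \<epsilon>_def)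
    have "\<epsilon> \<le> 1 / 2 * real n powr (1/3) * real n powr (-1/3)"
      unfolding \<epsilon>_def using lam(2) by (intro mult_right_mono) auto
    also have "\<dots> = 1 / 2" using n by (simp flip: powr_add)
    finally have \<epsilon>': "\<epsilon> \<le> 1 / 2" .
    have "40 ^ 3 \<le> \<bar>lam\<bar> ^ 3" using lam(1) by (intro power_mono) auto
    then have large: "64000 \<le> \<epsilon> ^ 3 * n" by (simp add: scale)
    show "1 - exp (- (\<kappa> * \<bar>lam\<bar> ^ 3)) \<le> measure_pmf.prob
          (random_formula n (1 / (2 * real n) * (1 + lam * real n powr (-1/3))))
          {F. (lam < 0 \<longrightarrow>
                 (\<exists>H. finite H \<and> real (card H) \<ge> \<kappa> * \<bar>lam\<bar> ^ 3 \<and>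
                   disjoint_hourglasses H \<and> mutually_strictly_distinct H \<and>
                   (\<forall>h\<in>H. is_hourglass (implication_digraph n F) h \<and>
                     real (card (in_portion h)) \<ge> real n powr (2/3) / lam\<^sup>2 \<and>
                     real (card (out_portion h)) \<ge> real n powr (2/3) / lam\<^sup>2))) \<and>
              (lam > 0 \<longrightarrow>
                 (\<exists>h. is_hourglass (implication_digraph n F) h \<and>
                   real (card (in_portion h)) \<in>
                     {1/320 * (lam * real n powr (2/3)) .. 1/5 * (lam * real n powr (2/3))} \<and>
                   real (card (out_portion h)) \<in>
                     {1/320 * (lam * real n powr (2/3)) .. 1/5 * (lam * real n powr (2/3))}))}"
      (is "_ \<le> measure_pmf.prob (random_formula n ?p) ?E")
    proof (cases "lam < 0")
      case True
      then have p: "?p = (1 - \<epsilon>) / (2 * real n)" by (simp add: \<epsilon>_def)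
      have "1 - exp (- (\<kappa> * \<bar>lam\<bar> ^ 3)) \<le> measure_pmf.prob (random_formula n ?p)
          {F. \<exists>w V H. 1 / \<epsilon>\<^sup>2 \<le> real w \<and> family n w F V H \<and> \<kappa> * \<bar>lam\<bar> ^ 3 \<le> card H}"
        using prob_subcritical_family [OF n \<epsilon> \<epsilon>' large, folded \<kappa>_def] unfolding p scale(1) .
      also have "\<dots> \<le> measure_pmf.prob (random_formula n ?p) ?E"
      proof (rule measure_pmf.finite_measure_mono, clarify)
        fix F w V H assume w: "1 / \<epsilon>\<^sup>2 \<le> real w" and fam: "family n w F V H"
          and card: "\<kappa> * \<bar>lam\<bar> ^ 3 \<le> card H"
        have "is_hourglass (implication_digraph n F) h \<and> real n powr (2/3) / lam\<^sup>2 \<le> card (in_portion h) \<and>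
            real n powr (2/3) / lam\<^sup>2 \<le> card (out_portion h)" if "h \<in> H" for h
        proof -
          have "is_hourglass (implication_digraph n F) h" "w \<le> card (in_portion h)" "w \<le> card (out_portion h)"
            using fam that by (auto simp: family_def)
          then show ?thesis unfolding scale(3) using w by linarith
        qed
        moreover have "finite H" using fam by (simp add: family_def)
        ultimately show "(lam < 0 \<longrightarrow>
                 (\<exists>H. finite H \<and> real (card H) \<ge> \<kappa> * \<bar>lam\<bar> ^ 3 \<and>
                   disjoint_hourglasses H \<and> mutually_strictly_distinct H \<and>
                   (\<forall>h\<in>H. is_hourglass (implication_digraph n F) h \<and>
                     real (card (in_portion h)) \<ge> real n powr (2/3) / lam\<^sup>2 \<and>
                     real (card (out_portion h)) \<ge> real n powr (2/3) / lam\<^sup>2))) \<and>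
              (lam > 0 \<longrightarrow>
                 (\<exists>h. is_hourglass (implication_digraph n F) h \<and>
                   real (card (in_portion h)) \<in>
                     {1/320 * (lam * real n powr (2/3)) .. 1/5 * (lam * real n powr (2/3))} \<and>
                   real (card (out_portion h)) \<in>
                     {1/320 * (lam * real n powr (2/3)) .. 1/5 * (lam * real n powr (2/3))}))"
          using card family_distinct [OF fam] True by (intro conjI impI exI [of _ H]) auto
      qed simp
      finally show ?thesis .
    next
      case False
      with lam(1) have pos: "0 < lam" by simp
      then have p: "?p = (1 + \<epsilon>) / (2 * real n)" by (simp add: \<epsilon>_def)
      have \<epsilon>n: "\<epsilon> * n = lam * real n powr (2/3)" using scale(2) pos by simp
      have "\<kappa> * \<bar>lam\<bar> ^ 3 \<le> 1 / 20480 * \<bar>lam\<bar> ^ 3" using \<kappa>' by (intro mult_right_mono) auto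
      then have "1 - exp (- (\<kappa> * \<bar>lam\<bar> ^ 3)) \<le> 1 - exp (- (\<epsilon> ^ 3 * n / 20480))"
        by (simp add: scale(1))
      also have "\<dots> \<le> measure_pmf.prob (random_formula n ?p) {F. \<exists>h. is_hourglass (implication_digraph n F) h \<and>
          card (in_portion h) \<in> {\<epsilon> * n / 320..\<epsilon> * n / 5} \<and> card (out_portion h) \<in> {\<epsilon> * n / 320..\<epsilon> * n / 5}}"
        unfolding p by (rule prob_supercritical_hourglass [OF n \<epsilon> \<epsilon>' large])
      also have "\<dots> \<le> measure_pmf.prob (random_formula n ?p) ?E"
        unfolding \<epsilon>n using pos by (intro measure_pmf.finite_measure_mono) auto
      finally show ?thesis .
    qed
  qed
qed

end
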